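(* Let $k$ be a positive integer and $\lambda$ a $k$-bounded partition. Then the dual $k$-Schur polynomial $\mathfrak{S}^{(k)}_\lambda$ (in finitely many variables $x_1,\ldots,x_n$) has saturated Newton polytope, and its Newton polytope is the $\lambda$-permutahedron $\mathcal{P}_\lambda$. Equivalently, $\mathfrak{S}^{(k)}_\lambda$ has M-convex support.
   Context: Partitions are Young diagrams in French notation; a partition is $k$-bounded if its largest part is at most $k$. Hook length of a cell: number of cells directly to its right in its row or directly above it in its column, counting the cell once; a $(k+1)$-core is a partition with no cell of hook length $k+1$; the $(k+1)$-residue of cell $(i,j)$ is $j-i\bmod(k+1)$. $\mathfrak{c}(\lambda)$ is the unique $(k+1)$-core whose row $i$ contains exactly $\lambda_i$ cells of hook length at most $k$ for every $i$. A semistandard $k$-tableau of shape $\mathfrak{c}(\lambda)$ is a semistandard Young tableau of that shape; its $k$-weight is $\alpha=(\alpha_1,\alpha_2,\ldots)$ where $\alpha_i$ is the number of distinct $(k+1)$-residues among cells filled with $i$. The dual $k$-Schur function is $\mathfrak{S}^{(k)}_\lambda=\sum_T x^{k\text{-weight}(T)}$ over all semistandard $k$-tableaux $T$ of shape $\mathfrak{c}(\lambda)$; the polynomial is obtained by setting $x_i=0$ for $i>n$. For a polynomial $f=\sum c_\alpha x^\alpha$ in $n$ variables, $\mathrm{supp}(f)=\{\alpha\in\mathbb{N}^n: c_\alpha\ne0\}$, $\mathrm{Newton}(f)$ is the convex hull of $\mathrm{supp}(f)$, and $f$ has saturated Newton polytope if $\mathrm{supp}(f)=\mathrm{Newton}(f)\cap\mathbb{Z}^n$.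 The $\lambda$-permutahedron $\mathcal{P}_\lambda\subseteq\mathbb{R}^n$ is the convex hull of all permutations of $(\lambda_1,\ldots,\lambda_n)$ (padding $\lambda$ with zeros). A set $J\subseteq\mathbb{N}^n$ is M-convex if for all $\alpha,\beta\in J$ and every $i$ with $\alpha_i>\beta_i$ there is $j$ with $\alpha_j<\beta_j$ and $\alpha-e_i+e_j\in J$.
   Formalization: Semistandard k-tableaux are additionally required to have k-weight of total |λ| (Lapointe–Morse), without which the claim fails (k=1, λ=(1,1)); Newton polytope = P_λ is claimed only when λ has at most n parts, as otherwise the polynomial is zero and padding is undefined. *)

theory Defs
  imports "HOL-Analysis.Analysis" "HOL-Library.Poly_Mapping"
begin

section \<open>Partitions, cores and residues\<close>

definition is_partition :: "nat list \<Rightarrow> bool" where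
  "is_partition la \<longleftrightarrow> sorted_wrt (\<ge>) la \<and> 0 \<notin> set la"

definition k_bounded :: "nat \<Rightarrow> nat list \<Rightarrow> bool" where
  "k_bounded k la \<longleftrightarrow> (\<forall>p \<in> set la. p \<le> k)"

text \<open>Rows and columns are counted from 0, so row \<open>i\<close> has length \<open>part la i\<close> (padded by zeros).
  Row 0 is the bottom row (French notation): a cell is above another one if its row index is larger.\<close>

definition part :: "nat list \<Rightarrow> nat \<Rightarrow> nat" where
  "part la i = (if i < length la then la ! i else 0)"

definition cells :: "nat list \<Rightarrow> (nat \<times> nat) set" where
  "cells la = {(i, j). j < part la i}"

definition hook_length :: "nat list \<Rightarrow> nat \<times> nat \<Rightarrow> nat" where
  "hook_length la = (\<lambda>(i, j).
     card {(i', j') \<in> cells la. (i' = i \<and> j \<le> j') \<or> (j' = j \<and> i \<le> i')})"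

definition is_core :: "nat \<Rightarrow> nat list \<Rightarrow> bool" where
  "is_core r la \<longleftrightarrow> is_partition la \<and> (\<forall>c \<in> cells la. hook_length la c \<noteq> r)"

definition residue :: "nat \<Rightarrow> nat \<times> nat \<Rightarrow> int" where
  "residue r = (\<lambda>(i, j). (int j - int i) mod int r)"

definition core_of :: "nat \<Rightarrow> nat list \<Rightarrow> nat list" where
  "core_of k la = (THE mu. is_core (k + 1) mu \<and>
     (\<forall>i. card {j. (i, j) \<in> cells mu \<and> hook_length mu (i, j) \<le> k} = part la i))"

section \<open>Semistandard k-tableaux and dual k-Schur functions\<close>

text \<open>A filling with positive integers is a function on all of \<open>nat \<times> nat\<close> that is 0 exactly outside
  the shape, so that fillings of a shape correspond one-to-one to such functions.\<close>

definition ssyt :: "nat list \<Rightarrow> (nat \<times> nat \<Rightarrow> nat) set" where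
  "ssyt mu = {T. (\<forall>c. 0 < T c \<longleftrightarrow> c \<in> cells mu) \<and>
     (\<forall>i j j'. (i, j) \<in> cells mu \<longrightarrow> (i, j') \<in> cells mu \<longrightarrow> j < j' \<longrightarrow> T (i, j) \<le> T (i, j')) \<and>
     (\<forall>i i' j. (i, j) \<in> cells mu \<longrightarrow> (i', j) \<in> cells mu \<longrightarrow> i < i' \<longrightarrow> T (i, j) < T (i', j))}"

definition k_weight :: "nat \<Rightarrow> nat list \<Rightarrow> (nat \<times> nat \<Rightarrow> nat) \<Rightarrow> nat \<Rightarrow> nat" where
  "k_weight k mu T m = card (residue (k + 1) ` {c \<in> cells mu. T c = m})"

text \<open>As in the definition of Lapointe and Morse, the \<open>k\<close>-weight of a semistandard \<open>k\<close>-tableau must be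
  a composition of the number of cells of hook length at most \<open>k\<close> of its shape, which is \<open>|la|\<close>. This
  does not hold for every semistandard tableau of shape \<open>core_of k la\<close>: for \<open>k = 1\<close>, \<open>la = (1,1)\<close> the
  core is \<open>(2,1)\<close>, and the tableau with bottom row 1 2 and top row 3 has 1-weight \<open>(1,1,1)\<close>.\<close>

definition k_tableaux :: "nat \<Rightarrow> nat list \<Rightarrow> (nat \<times> nat \<Rightarrow> nat) set" where
  "k_tableaux k la = {T \<in> ssyt (core_of k la).
     (\<Sum>m \<in> T ` cells (core_of k la). k_weight k (core_of k la) T m) = sum_list la}"

text \<open>The formal power series in \<open>x\<^sub>1, x\<^sub>2, \<dots>\<close>, given by its coefficients: \<open>dual_k_schur k la a\<close> is
  the coefficient of the monomial \<open>x\<^sup>a\<close>.\<close>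

definition dual_k_schur :: "nat \<Rightarrow> nat list \<Rightarrow> (nat \<Rightarrow> nat) \<Rightarrow> int" where
  "dual_k_schur k la a = int (card {T \<in> k_tableaux k la. k_weight k (core_of k la) T = a})"

text \<open>Polynomials over the integers in \<open>n = CARD('n)\<close> variables are elements of the monoid ring of the
  exponent vectors \<open>nat ^ 'n\<close>. The index type is enumerated by \<open>from_nat_into UNIV\<close>, which is a
  bijection from \<open>{..<n}\<close>; so \<open>x\<^sub>m\<close> with \<open>1 \<le> m \<le> n\<close> is the variable with index
  \<open>from_nat_into UNIV (m - 1)\<close>. Setting \<open>x\<^sub>m = 0\<close> for \<open>m > n\<close> keeps the coefficients of the exponents
  that vanish beyond \<open>n\<close>.\<close>

definition pad_exponent :: "nat ^ 'n \<Rightarrow> nat \<Rightarrow> nat" where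
  "pad_exponent a m = (if m \<in> {1..CARD('n)} then a $ from_nat_into UNIV (m - 1) else 0)"

definition dual_k_schur_poly :: "nat \<Rightarrow> nat list \<Rightarrow> (nat ^ 'n) \<Rightarrow>\<^sub>0 int" where
  "dual_k_schur_poly k la = Abs_poly_mapping (\<lambda>a. dual_k_schur k la (pad_exponent a))"

text \<open>The family of coefficients has finite support, so the above is indeed a polynomial.\<close>

lemma finite_cells: "finite (cells mu)"
proof -
  have "cells mu \<subseteq> (SIGMA i:{..<length mu}. {..<part mu i})"
    by (auto simp: cells_def part_def split: if_splits)
  then show ?thesis
    by (rule finite_subset) auto
qed

lemma k_weight_le: "k_weight k mu T m \<le> card (cells mu)"
proof -
  have "k_weight k mu T m \<le> card {c \<in> cells mu. T c = m}"
    unfolding k_weight_def by (rule card_image_le) (simp add: finite_cells)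
  also have "\<dots> \<le> card (cells mu)"
    by (rule card_mono) (auto simp: finite_cells)
  finally show ?thesis .
qed

lemma lookup_dual_k_schur_poly:
  fixes a :: "nat ^ 'n"
  shows "Poly_Mapping.lookup (dual_k_schur_poly k la) a = dual_k_schur k la (pad_exponent a)"
proof -
  let ?N = "card (cells (core_of k la))"
  have "{a :: nat ^ 'n. dual_k_schur k la (pad_exponent a) \<noteq> 0}
      \<subseteq> vec_lambda ` (UNIV \<rightarrow>\<^sub>E {..?N})"
  proof
    fix a :: "nat ^ 'n"
    assume "a \<in> {a. dual_k_schur k la (pad_exponent a) \<noteq> 0}"
    then have "{T \<in> k_tableaux k la. k_weight k (core_of k la) T = pad_exponent a} \<noteq> {}"
      unfolding dual_k_schur_def by (metis (mono_tags, lifting) card.empty mem_Collect_eq of_nat_0)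
    then obtain T where T: "k_weight k (core_of k la) T = pad_exponent a"
      by blast
    have "a $ i \<le> ?N" for i
    proof -
      have "to_nat_on (UNIV :: 'n set) i < CARD('n)"
        using to_nat_on_finite[of "UNIV :: 'n set"] by (auto simp: bij_betw_def)
      then have "pad_exponent a (Suc (to_nat_on UNIV i)) = a $ i"
        by (simp add: pad_exponent_def countable_finite)
      then show ?thesis
        by (metis T k_weight_le)
    qed
    then show "a \<in> vec_lambda ` (UNIV \<rightarrow>\<^sub>E {..?N})"
      by (intro image_eqI[of _ _ "vec_nth a"]) auto
  qed
  moreover have "finite (vec_lambda ` ((UNIV :: 'n set) \<rightarrow>\<^sub>E {..?N}))"
    by (intro finite_imageI finite_PiE) auto
  ultimately show ?thesis
    unfolding dual_k_schur_poly_def by (subst Abs_poly_mapping_inverse) (auto dest: finite_subset)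
qed

section \<open>Newton polytopes, permutahedra and M-convex sets\<close>

definition supp :: "((nat ^ 'n) \<Rightarrow>\<^sub>0 int) \<Rightarrow> (nat ^ 'n) set" where
  "supp f = Poly_Mapping.keys f"

definition real_vec :: "nat ^ 'n \<Rightarrow> real ^ 'n" where
  "real_vec a = (\<chi> i. real (a $ i))"

definition newton :: "((nat ^ 'n) \<Rightarrow>\<^sub>0 int) \<Rightarrow> (real ^ 'n) set" where
  "newton f = convex hull (real_vec ` supp f)"

definition saturated_newton_polytope :: "((nat ^ 'n) \<Rightarrow>\<^sub>0 int) \<Rightarrow> bool" where
  "saturated_newton_polytope f \<longleftrightarrow> real_vec ` supp f = newton f \<inter> {x. \<forall>i. x $ i \<in> \<int>}"

text \<open>This is the \<open>la\<close>-permutahedron provided that \<open>la\<close> has at most \<open>n = CARD('n)\<close> parts.\<close>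

definition permutahedron :: "nat list \<Rightarrow> (real ^ 'n) set" where
  "permutahedron la =
     convex hull {(\<chi> i. real (part la (s i))) |s. bij_betw s (UNIV :: 'n set) {..<CARD('n)}}"

text \<open>The subtraction below is not truncated, because \<open>a $ i > 0\<close>.\<close>

definition M_convex :: "(nat ^ 'n) set \<Rightarrow> bool" where
  "M_convex J \<longleftrightarrow> (\<forall>a \<in> J. \<forall>b \<in> J. \<forall>i. a $ i > b $ i \<longrightarrow>
     (\<exists>j. a $ j < b $ j \<and> a - axis i 1 + axis j 1 \<in> J))"

end

theory Submission
  imports Defs
begin

text \<open>The \<open>(k + 1)\<close>-core with bounded partition \<open>l\<close> has row lengths \<open>g\<close> with
  \<open>g i = l i + g (i + k + 1 - l i)\<close>: row \<open>i\<close> starts its cells of hook length at most \<open>k\<close> where the row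
  \<open>k + 1 - l i\<close> steps above ends. In terms of the beads \<open>g i - i\<close> of the abacus, subtracting \<open>k + 1\<close>
  from a bead gives a bead again.

  Let \<open>R\<close> be the set of residues of the cells of the largest entry of a semistandard tableau \<open>T\<close>. Removing
  from every row of the core a longest end with residues in \<open>R\<close>, without entering the columns of the
  row above, gives a core again, which contains none of these cells and whose bounded partition
  has lost a horizontal strip of at most \<open>card R\<close> cells. By induction the \<open>k\<close>-weight of \<open>T\<close> has total at least
  \<open>|la|\<close>, and if equality holds it is dominated by \<open>la\<close>. Conversely, every dominated vector
  is a \<open>k\<close>-weight: remove greedily from \<open>la\<close> the horizontal strip of the prescribed size that leaves
  the dominance-largest partition; the corresponding strip of the core has as many residues.
  So the support consists of the integer points dominated by \<open>la\<close>, the bases of an integral polymatroid.\<close>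

section \<open>Cores on the abacus\<close>

text \<open>The content of the first cell outside row \<open>i\<close>. For antitone
  \<open>g\<close> the beads decrease strictly, and their set is the Maya diagram of the
  shape.\<close>

definition bead :: "(nat \<Rightarrow> nat) \<Rightarrow> nat \<Rightarrow> int" where
  "bead g i = int (g i) - int i"

text \<open>Rows are functions with no built-in finite support, so uniqueness results assume
  vanishing from some row \<open>M\<close> on. By \<open>l i \<le> k\<close> the jump
  \<open>k + 1 - l i\<close> is positive and not truncated.\<close>

definition core_rows :: "nat \<Rightarrow> (nat \<Rightarrow> nat) \<Rightarrow> (nat \<Rightarrow> nat) \<Rightarrow> bool" where
  "core_rows k l g \<longleftrightarrow> antimono g \<and> (\<forall>i. l i \<le> k \<and> g i = l i + g (i + (k + 1 - l i)))"

lemma core_rowsD: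
  assumes "core_rows k l g"
  shows "antimono g" "l i \<le> k" "g i = l i + g (i + (k + 1 - l i))"
  using assms unfolding core_rows_def by blast+

lemma bead_less_iff:
  assumes "antimono g"
  shows "bead g j < bead g i \<longleftrightarrow> i < j"
proof -
  have less: "bead g j < bead g i" if "i < j" for i j
    using antimonoD[OF assms, of i j] that by (simp add: bead_def)
  show ?thesis
    using less[of i j] less[of j i] by (cases i j rule: linorder_cases) auto
qed

lemma bead_le_iff:
  assumes "antimono g"
  shows "bead g j \<le> bead g i \<longleftrightarrow> i \<le> j"
  using bead_less_iff[OF assms, of i j] by (simp add: linorder_not_less[symmetric] bead_less_iff[OF assms])

lemma bead_eq_iff:
  assumes "antimono g"
  shows "bead g j = bead g i \<longleftrightarrow> i = j"
  by (simp add: order_eq_iff bead_le_iff[OF assms] conj_commute)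

lemma bead_shift:
  assumes "core_rows k l g"
  shows "bead g (i + (k + 1 - l i)) = bead g i - int (k + 1)"
  using core_rowsD(2,3)[OF assms, of i] by (simp add: bead_def of_nat_diff)

text \<open>Iterating \<open>bead_shift\<close>: a runner of the abacus has no gap below any of its
  beads.\<close>

lemma bead_flush:
  assumes "core_rows k l g" "c \<in> range (bead g)"
  shows "c - int t * int (k + 1) \<in> range (bead g)"
proof (induction t)
  case (Suc t)
  then obtain i where "c - int t * int (k + 1) = bead g i" by blast
  then have "c - int (Suc t) * int (k + 1) = bead g (i + (k + 1 - l i))"
    using bead_shift[OF assms(1), of i] by (simp add: algebra_simps)
  then show ?case by blast
qed (use assms in simp)

text \<open>A flush abacus determines the bounded partition: if row \<open>j\<close> carries the
  bead \<open>k + 1\<close> places below that of row \<open>i\<close>, antitony forces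
  \<open>0 < j - i \<le> k + 1\<close>, and \<open>l i\<close> is
  \<open>k + 1 - (j - i)\<close>.\<close>

lemma core_rows_exI:
  assumes "antimono g" and flush: "\<And>i. bead g i - int (k + 1) \<in> range (bead g)"
  shows "\<exists>l. core_rows k l g"
proof -
  have "\<exists>x\<le>k. g i = x + g (i + (k + 1 - x))" for i
  proof -
    obtain j where j: "bead g i - int (k + 1) = bead g j" using flush by blast
    then have "bead g j < bead g i" by simp
    then have ij: "i < j" by (simp add: bead_less_iff[OF assms(1)])
    then have "g j \<le> g i" using assms(1) by (simp add: antimonoD)
    then have "j - i \<le> k + 1" using j ij by (simp add: bead_def)
    then show ?thesis using j ij
      by (intro exI[of _ "k + 1 - (j - i)"]) (auto simp: bead_def)
  qed
  then obtain l where "\<forall>i. l i \<le> k \<and> g i = l i + g (i + (k + 1 - l i))" by metis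
  then show ?thesis using assms(1) unfolding core_rows_def by blast
qed

text \<open>Column \<open>j\<close> ends in row \<open>i\<close>, so the content lies strictly
  between the beads of rows \<open>i + 1\<close> and \<open>i\<close>.\<close>

lemma row_gap:
  assumes "antimono g" "g (Suc i) \<le> j" "j < g i"
  shows "int j - int i \<notin> range (bead g)"
proof
  assume "int j - int i \<in> range (bead g)"
  then obtain p where p: "int j - int i = bead g p" by blast
  have "bead g p < bead g i" "bead g (Suc i) < bead g p"
    using assms(2,3) p by (auto simp: bead_def)
  then show False by (simp add: bead_less_iff[OF assms(1)])
qed

text \<open>Each row is expressed by a higher one, so induction descends from \<open>M\<close>. The
  threshold \<open>r\<close> serves \<open>greedy_strip\<close>, where a shifted core satisfies the
  equations only above the merged row.\<close>

lemma core_rows_unique: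
  fixes g h l :: "nat \<Rightarrow> nat"
  assumes g: "\<And>i. r \<le> i \<Longrightarrow> l i \<le> k \<and> g i = l i + g (i + (k + 1 - l i))"
    and h: "\<And>i. r \<le> i \<Longrightarrow> l i \<le> k \<and> h i = l i + h (i + (k + 1 - l i))"
    and zero: "\<And>i. M \<le> i \<Longrightarrow> g i = 0 \<and> h i = 0"
    and "r \<le> i"
  shows "g i = h i"
  using \<open>r \<le> i\<close>
proof (induction i rule: measure_induct_rule[where f = "\<lambda>i. M - i"])
  case (less i)
  show ?case
  proof (cases "M \<le> i")
    case False
    have "l i \<le> k" using g less.prems by blast
    then have "g (i + (k + 1 - l i)) = h (i + (k + 1 - l i))"
      using False less.prems by (intro less.IH) auto
    then show ?thesis using g[OF less.prems] h[OF less.prems] by simp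
  qed (use zero in simp)
qed

lemma core_rows_inject:
  assumes g: "core_rows k l g" and h: "core_rows k l h"
    and zero: "\<And>i. M \<le> i \<Longrightarrow> g i = 0 \<and> h i = 0"
  shows "g = h"
proof
  show "g i = h i" for i
  proof (rule core_rows_unique[of 0 l k g h M])
    show "l i \<le> k \<and> g i = l i + g (i + (k + 1 - l i))"
      "l i \<le> k \<and> h i = l i + h (i + (k + 1 - l i))" for i
      using core_rowsD(2,3)[OF g] core_rowsD(2,3)[OF h] by blast+
  qed (use zero in auto)
qed

text \<open>Both guards secure termination: for \<open>k < l i\<close> the truncated jump
  \<open>k + 1 - l i\<close> would be 0.\<close>

function core_row :: "nat \<Rightarrow> (nat \<Rightarrow> nat) \<Rightarrow> nat \<Rightarrow> nat \<Rightarrow> nat" where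
  "core_row k l M i = (if M \<le> i \<or> k < l i then 0 else l i + core_row k l M (i + (k + 1 - l i)))"
  by auto
termination by (relation "Wellfounded.measure (\<lambda>(k, l, M, i). M - i)") auto

declare core_row.simps [simp del]

lemma core_rows_core_row:
  assumes "antimono l" and bound: "\<And>i. l i \<le> k" and zero: "\<And>i. M \<le> i \<Longrightarrow> l i = 0"
  shows "core_rows k l (core_row k l M)" and "M \<le> i \<Longrightarrow> core_row k l M i = 0"
proof -
  let ?g = "core_row k l M"
  show z: "?g i = 0" if "M \<le> i" for i using that by (simp add: core_row.simps)
  have eq: "?g i = l i + ?g (i + (k + 1 - l i))" for i
  proof (cases "M \<le> i")
    case False
    then show ?thesis using bound[of i] by (subst core_row.simps) auto
  qed (simp add: z zero)
  \<comment> \<open>Rows \<open>i\<close> and \<open>i + 1\<close> are compared through their jump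
    targets, which may be several rows apart; hence the claim for all
    \<open>j \<ge> i\<close>.\<close>
  have "\<forall>j\<ge>i. ?g j \<le> ?g i" for i
  proof (induction i rule: measure_induct_rule[where f = "\<lambda>i. M - i"])
    case (less i)
    show ?case
    proof (cases "M \<le> i")
      case True
      then show ?thesis by (auto simp: z)
    next
      case False
      have "?g (Suc i) \<le> ?g i"
      proof -
        have li: "l (Suc i) \<le> l i" "l i \<le> k" using assms(1) bound by (auto simp: antimonoD)
        have "?g (Suc i + (k + 1 - l (Suc i))) \<le> ?g (i + (k + 1 - l i))"
          using less.IH[of "i + (k + 1 - l i)"] False li by auto
        then show ?thesis using eq[of i] eq[of "Suc i"] li by linarith
      qed
      moreover have "\<forall>j\<ge>Suc i. ?g j \<le> ?g (Suc i)" using less.IH[of "Suc i"] False by auto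
      ultimately show ?thesis by (metis le_trans not_less_eq_eq order_antisym_conv order_refl)
    qed
  qed
  then have "antimono ?g" by (auto intro!: antimonoI)
  then show "core_rows k l ?g" unfolding core_rows_def using bound eq by blast
qed

text \<open>A cell lost from row \<open>i\<close> of the bounded partition is matched with a content of the strip that
  is the lowest gap of its runner on the abacus. A residue class has only one such gap, so the size of
  the bounded partition drops by at most the number of residues of the strip.\<close>

lemma strip_rows:
  assumes c: "core_rows k l g" and c': "core_rows k l' g'"
    and sub: "\<And>i. g' i \<le> g i" and hor: "\<And>i. g (Suc i) \<le> g' i"
  shows "l' i \<le> l i" and "l (Suc i) \<le> l' i"
    and "card {j \<in> {g' i..<g i}. int j - int i - int (k + 1) \<in> range (bead g)} = l i - l' i"
proof -
  note less = bead_less_iff[OF core_rowsD(1)[OF c]] and le = bead_le_iff[OF core_rowsD(1)[OF c]]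
    and eq = bead_eq_iff[OF core_rowsD(1)[OF c]]
  define p where "p = i + (k + 1 - l i)"
  define p' where "p' = i + (k + 1 - l' i)"
  have p: "bead g p = bead g i - int (k + 1)" unfolding p_def by (rule bead_shift[OF c])
  have p': "bead g' p' = bead g' i - int (k + 1)" unfolding p'_def by (rule bead_shift[OF c'])
  \<comment> \<open>Removing a horizontal strip interlaces the beads:
    \<open>bead g (Suc j) < bead g' j \<le> bead g j\<close>.\<close>
  have sub': "bead g' j \<le> bead g j" for j using sub[of j] by (simp add: bead_def)
  have hor': "bead g (Suc j) < bead g' j" for j using hor[of j] by (simp add: bead_def)
  have "bead g (Suc p') < bead g p"
    using hor'[of p'] p' p sub'[of i] by linarith
  then have pp': "p \<le> p'" by (simp add: less)
  then show ll: "l' i \<le> l i"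
    using core_rowsD(2)[OF c, of i] core_rowsD(2)[OF c', of i] by (simp add: p_def p'_def)
  have "bead g (Suc i + (k + 1 - l (Suc i))) < bead g p'"
    using bead_shift[OF c, of "Suc i"] hor'[of i] p' sub'[of p'] by linarith
  then have "p' < Suc i + (k + 1 - l (Suc i))" by (simp add: less)
  then show "l (Suc i) \<le> l' i"
    using core_rowsD(2)[OF c, of "Suc i"] core_rowsD(2)[OF c', of i] by (simp add: p'_def)
  \<comment> \<open>The bead of a row \<open>q\<close> with \<open>p < q \<le> p'\<close>, raised by
    \<open>k + 1\<close>, is the content of a removed cell of row \<open>i\<close>; there are
    \<open>p' - p = l i - l' i\<close> such rows.\<close>
  have "bij_betw (\<lambda>q. nat (bead g q + int (k + 1) + int i)) {p<..p'}
      {j \<in> {g' i..<g i}. int j - int i - int (k + 1) \<in> range (bead g)}"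
  proof (rule bij_betwI')
    have ge: "bead g q \<ge> bead g' p'" if "q \<le> p'" for q
      using sub'[of p'] that le[of p' q] by linarith
    have nn: "bead g q + int (k + 1) + int i \<ge> int (g' i)" if "q \<in> {p<..p'}" for q
      using ge[of q] that p' by (simp add: bead_def)
    show "nat (bead g x + int (k + 1) + int i) = nat (bead g y + int (k + 1) + int i) \<longleftrightarrow> x = y"
      if "x \<in> {p<..p'}" "y \<in> {p<..p'}" for x y
      using nn[OF that(1)] nn[OF that(2)] eq[of x y] by (auto simp: nat_eq_iff)
    show "nat (bead g x + int (k + 1) + int i)
        \<in> {j \<in> {g' i..<g i}. int j - int i - int (k + 1) \<in> range (bead g)}"
      if "x \<in> {p<..p'}" for x
    proof -
      have "bead g x < bead g p" using that by (simp add: less)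
      then show ?thesis using nn[OF that] p by (auto simp: bead_def)
    qed
    show "\<exists>x\<in>{p<..p'}. y = nat (bead g x + int (k + 1) + int i)"
      if y: "y \<in> {j \<in> {g' i..<g i}. int j - int i - int (k + 1) \<in> range (bead g)}" for y
    proof -
      obtain q where q: "int y - int i - int (k + 1) = bead g q" using y by blast
      have "bead g q < bead g p" using y q p by (simp add: bead_def)
      then have "p < q" by (simp add: less)
      moreover have "bead g' p' \<le> bead g q" using y q p' by (simp add: bead_def)
      then have "bead g (Suc p') < bead g q" using hor'[of p'] by linarith
      then have "q \<le> p'" by (simp add: less)
      ultimately show ?thesis using q by (intro bexI[of _ q]) auto
    qed
  qed
  then have "card {j \<in> {g' i..<g i}. int j - int i - int (k + 1) \<in> range (bead g)} = card {p<..p'}"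
    by (rule bij_betw_same_card[symmetric])
  also have "\<dots> = l i - l' i"
    using core_rowsD(2)[OF c, of i] ll by (simp add: p_def p'_def)
  finally show "card {j \<in> {g' i..<g i}. int j - int i - int (k + 1) \<in> range (bead g)} = l i - l' i" .
qed

lemma residue_eq_imp:
  assumes "residue r (i, j) = residue r (i', j')" "int j - int i \<le> int j' - int i'"
  obtains t where "int j - int i = int j' - int i' - int t * int r"
proof -
  have "int r dvd (int j' - int i') - (int j - int i)"
    using assms(1) by (simp add: residue_def mod_eq_dvd_iff dvd_diff_commute)
  then obtain d where d: "(int j' - int i') - (int j - int i) = int r * d" by blast
  show thesis
  proof (cases "r = 0")
    case True
    then show ?thesis using d that[of 0] by simp
  next
    case False
    then have "d \<ge> 0" using d assms(2) by (smt (verit) mult_pos_neg of_nat_0_less_iff gr0I)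
    then show ?thesis using d that[of "nat d"] by (simp add: algebra_simps)
  qed
qed

text \<open>The cells \<open>G i\<close> counted by \<open>strip_rows\<close> lie in gaps just above
  a bead of their runner. By flushness equal residues force equal contents, and the beads enclosing
  a content fix its row, so these cells have distinct residues.\<close>

lemma sum_loss_le_residues:
  assumes c: "core_rows k l g" and c': "core_rows k l' g'"
    and sub: "\<And>i. g' i \<le> g i" and hor: "\<And>i. g (Suc i) \<le> g' i"
    and fin: "finite R" and R: "\<And>i j. g' i \<le> j \<Longrightarrow> j < g i \<Longrightarrow> residue (k + 1) (i, j) \<in> R"
  shows "sum l {..<M} \<le> sum l' {..<M} + card R"
proof -
  note anti = core_rowsD(1)[OF c]
  define G where "G i = {j \<in> {g' i..<g i}. int j - int i - int (k + 1) \<in> range (bead g)}" for i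
  have G: "card (G i) = l i - l' i" "l' i \<le> l i" for i
    unfolding G_def using strip_rows[OF c c' sub hor] by auto
  have gap: "int j - int i \<notin> range (bead g)" if "j \<in> G i" for i j
    using row_gap[OF anti, of i j] that hor[of i] by (auto simp: G_def)
  have inj1: "int j - int i = int j' - int i'"
    if ji: "j \<in> G i" "j' \<in> G i'" and eq: "residue (k + 1) (i, j) = residue (k + 1) (i', j')"
      and le: "int j - int i \<le> int j' - int i'" for i j i' j'
  proof -
    obtain t where t: "int j - int i = int j' - int i' - int t * int (k + 1)"
      using residue_eq_imp[OF eq le] by blast
    show ?thesis
    proof (cases t)
      case (Suc u)
      have "int j' - int i' - int (k + 1) \<in> range (bead g)" using ji(2) by (simp add: G_def)
      moreover have "int j' - int i' - int (k + 1) - int u * int (k + 1) = int j - int i"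
        using t Suc by (simp add: algebra_simps)
      ultimately have "int j - int i \<in> range (bead g)" using bead_flush[OF c, of _ u] by metis
      then show ?thesis using gap[OF ji(1)] by blast
    qed (use t in simp)
  qed
  have inj: "inj_on (residue (k + 1)) (SIGMA i:{..<M}. G i)"
  proof (rule inj_onI, clarify)
    fix i j i' j' assume ji: "j \<in> G i" "j' \<in> G i'"
      and eq: "residue (k + 1) (i, j) = residue (k + 1) (i', j')"
    have eq': "int j - int i = int j' - int i'"
      using inj1[OF ji eq] inj1[OF ji(2,1) eq[symmetric]] by linarith
    have rng: "bead g (Suc i) < int j - int i" "int j - int i < bead g i"
      if "j \<in> G i" for i j
      using that hor[of i] by (auto simp: G_def bead_def)
    have "bead g (Suc i) < bead g i'" "bead g (Suc i') < bead g i"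
      using rng[OF ji(1)] rng[OF ji(2)] eq' by linarith+
    then have "i = i'" by (simp add: bead_less_iff[OF anti])
    then show "i = i' \<and> j = j'" using eq' by simp
  qed
  have "sum l {..<M} = sum l' {..<M} + (\<Sum>i<M. card (G i))"
    by (simp add: G sum.distrib[symmetric])
  also have "(\<Sum>i<M. card (G i)) = card (SIGMA i:{..<M}. G i)"
    by (simp add: G_def)
  also have "\<dots> = card (residue (k + 1) ` (SIGMA i:{..<M}. G i))"
    using card_image[OF inj] by simp
  also have "\<dots> \<le> card R"
    using R by (intro card_mono[OF fin]) (auto simp: G_def)
  finally show ?thesis by simp
qed

section \<open>Removing strips from cores\<close>

lemma residue_shift:
  assumes "int j' - int i' = int j - int i + t * int r"
  shows "residue r (i', j') = residue r (i, j)"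
  using assms by (simp add: residue_def)

text \<open>This is \<open>strip_rows\<close> for the empty strip \<open>g' = g\<close>.\<close>

lemma core_rows_antimono:
  assumes "core_rows k l g"
  shows "antimono l"
  using strip_rows(2)[OF assms assms] core_rowsD(1)[OF assms]
  by (auto simp: antimono_iff_le_Suc)

text \<open>Raising a gap by multiples of \<open>k + 1\<close> keeps it a gap, since a bead would
  force beads below it. It ends in the window just below \<open>bead g p\<close>, and not at the
  lower end, which is a bead.\<close>

lemma gap_residue_in_window:
  assumes c: "core_rows k l g" and gap: "int j - int i \<notin> range (bead g)" and low: "int j - int i < bead g p"
  shows "residue (k + 1) (i, j)
    \<in> (\<lambda>x. x mod int (k + 1)) ` ({bead g p - int (k + 1)<..<bead g p} - range (bead g))"
proof -
  define c0 where "c0 = int j - int i"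
  define t where "t = nat ((bead g p - 1 - c0) div int (k + 1))"
  have t: "int t = (bead g p - 1 - c0) div int (k + 1)"
    using low by (simp add: t_def c0_def pos_imp_zdiv_nonneg_iff)
  define x where "x = c0 + int t * int (k + 1)"
  have x: "x = bead g p - 1 - (bead g p - 1 - c0) mod int (k + 1)"
    unfolding x_def t by (simp add: minus_mod_eq_mult_div[symmetric] algebra_simps)
  have "(bead g p - 1 - c0) mod int (k + 1) < int (k + 1)" "0 \<le> (bead g p - 1 - c0) mod int (k + 1)"
    by simp_all
  then have "bead g p - int (k + 1) \<le> x" "x < bead g p" unfolding x by linarith+
  moreover have xg: "x \<notin> range (bead g)"
    using bead_flush[OF c, of x t] gap by (auto simp: x_def c0_def)
  moreover have "bead g p - int (k + 1) \<in> range (bead g)"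
    using bead_shift[OF c, of p] by (metis rangeI)
  ultimately have "x \<in> {bead g p - int (k + 1)<..<bead g p} - range (bead g)"
    by (metis DiffI greaterThanLessThan_iff order_le_less)
  moreover have "residue (k + 1) (i, j) = x mod int (k + 1)"
    by (simp add: residue_def x_def c0_def)
  ultimately show ?thesis by blast
qed

text \<open>Of the \<open>k\<close> places in the window, \<open>k - l p\<close> hold beads: those
  of the rows strictly between \<open>p\<close> and its jump target.\<close>

lemma card_window_gaps:
  assumes c: "core_rows k l g"
  shows "card ({bead g p - int (k + 1)<..<bead g p} - range (bead g)) = l p"
proof -
  note less = bead_less_iff[OF core_rowsD(1)[OF c]]
  have sh: "bead g (p + (k + 1 - l p)) = bead g p - int (k + 1)" by (rule bead_shift[OF c])
  have eq: "{bead g p - int (k + 1)<..<bead g p} \<inter> range (bead g) = bead g ` {p<..<p + (k + 1 - l p)}"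
    unfolding sh[symmetric] by (auto simp: less)
  have "inj_on (bead g) A" for A
    by (auto intro!: inj_onI simp: bead_eq_iff[OF core_rowsD(1)[OF c]])
  then have "card ({bead g p - int (k + 1)<..<bead g p} \<inter> range (bead g)) = k - l p"
    using core_rowsD(2)[OF c, of p] unfolding eq by (subst card_image) auto
  moreover have "card {bead g p - int (k + 1)<..<bead g p} = k" by simp
  ultimately show ?thesis
    using core_rowsD(2)[OF c, of p] by (simp add: card_Diff_subset_Int)
qed

text \<open>Of all horizontal strips of size \<open>m\<close> this one leaves the dominance-largest partition. On the
  core, the strip above row \<open>r\<close> consists of gaps below the bead of row \<open>r + 1\<close>, which have
  \<open>l (r + 1)\<close> residues, and the strip below row \<open>r\<close> only repeats residues.\<close>

lemma greedy_strip:
  assumes c: "core_rows k l g" and zero: "\<And>i. M \<le> i \<Longrightarrow> g i = 0"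
    and m: "l (Suc r) \<le> m" "m \<le> l r"
  defines "l' \<equiv> \<lambda>i. if i < r then l i else if i = r then l r + l (Suc r) - m else l (Suc i)"
  shows "\<exists>g'. core_rows k l' g' \<and> (\<forall>i. g' i \<le> g i \<and> g (Suc i) \<le> g' i) \<and>
    card (residue (k + 1) ` {(i, j). g' i \<le> j \<and> j < g i}) \<le> m"
proof -
  note anti = core_rowsD(1)[OF c] and lk = core_rowsD(2)[OF c] and geq = core_rowsD(3)[OF c]
  note lanti = core_rows_antimono[OF c]
  have lS: "l (Suc i) \<le> l i" for i using lanti by (simp add: antimonoD)
  have l'k: "l' i \<le> k" for i
    using lk[of i] lk[of r] lk[of "Suc r"] lk[of "Suc i"] m by (auto simp: l'_def)
  have l'S: "l' (Suc i) \<le> l' i" for i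
  proof -
    have "l (Suc r) \<le> l i" if "i < r" using lanti that by (simp add: antimonoD)
    moreover have "l (Suc (Suc r)) \<le> l (Suc r)" by (rule lS)
    moreover have "Suc i = r \<Longrightarrow> l r \<le> l i" using lS[of i] by auto
    ultimately show ?thesis using m lS[of i] lS[of "Suc i"] by (auto simp: l'_def)
  qed
  have l'z: "l' i = 0" if "max M (Suc r) \<le> i" for i
    using zero[of "Suc i"] geq[of "Suc i"] that by (auto simp: l'_def)
  define g' where "g' = core_row k l' (max M (Suc r))"
  have l'a: "antimono l'" using l'S by (simp add: antimono_iff_le_Suc)
  have c': "core_rows k l' g'"
    unfolding g'_def by (rule core_rows_core_row(1)[OF l'a]) (use l'k l'z in blast)+
  have g'z: "g' i = 0" if "max M (Suc r) \<le> i" for i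
    unfolding g'_def using that by (simp add: core_row.simps)
  note anti' = core_rowsD(1)[OF c'] and geq' = core_rowsD(3)[OF c']
  \<comment> \<open>Above row \<open>r\<close> the partition has moved down by one row, and the core
    moves with it.\<close>
  have top: "g' i = g (Suc i)" if "Suc r \<le> i" for i
  proof (rule core_rows_unique[where h = "\<lambda>i. g (Suc i)" and l = "l'" and r = "Suc r" and M = "max M (Suc r)"])
    show "l' i \<le> k \<and> g' i = l' i + g' (i + (k + 1 - l' i))" for i using l'k geq' by blast
    show "l' i \<le> k \<and> g (Suc i) = l' i + g (Suc (i + (k + 1 - l' i)))" if "Suc r \<le> i" for i
      using geq[of "Suc i"] lk[of "Suc i"] that by (auto simp: l'_def)
    show "g' i = 0 \<and> g (Suc i) = 0" if "max M (Suc r) \<le> i" for i using g'z[of i] zero[of "Suc i"] that by auto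
  qed (rule that)
  have strip: "g' i \<le> g i \<and> g (Suc i) \<le> g' i" for i
  proof (induction i rule: measure_induct_rule[where f = "\<lambda>i. max M (Suc r) - i"])
    case (less i)
    consider "r < i" | "i = r" | "i < r" by linarith
    then show ?case
    proof cases
      case 1
      then show ?thesis using top[of i] anti by (simp add: antimonoD)
    next
      case 2
      have "g' r = l' r + g (Suc (r + (k + 1 - l' r)))"
        using geq'[of r] top[of "r + (k + 1 - l' r)"] l'k[of r] by simp
      moreover have "l (Suc r) \<le> l' r" "l' r \<le> l r" using m by (auto simp: l'_def)
      moreover have "g (Suc (r + (k + 1 - l' r))) \<le> g (r + (k + 1 - l r))"
        using \<open>l' r \<le> l r\<close> l'k[of r] lk[of r] anti by (intro antimonoD[OF anti]) auto
      moreover have "g (Suc r + (k + 1 - l (Suc r))) \<le> g (Suc (r + (k + 1 - l' r)))"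
        using \<open>l (Suc r) \<le> l' r\<close> l'k[of r] anti by (intro antimonoD[OF anti]) auto
      ultimately show ?thesis using geq[of r] geq[of "Suc r"] unfolding 2 by (intro conjI) linarith+
    next
      case 3
      let ?i = "i + (k + 1 - l i)"
      have l'i: "l' i = l i" using 3 by (simp add: l'_def)
      have IH: "g' ?i \<le> g ?i \<and> g (Suc ?i) \<le> g' ?i"
        using less.IH[of ?i] 3 lk[of i] by auto
      have "g (Suc i + (k + 1 - l (Suc i))) \<le> g (Suc ?i)"
        using anti lS[of i] by (intro antimonoD[OF anti]) auto
      then show ?thesis
        using IH geq'[of i, unfolded l'i] geq[of i] geq[of "Suc i"] lS[of i] by (intro conjI) linarith+
    qed
  qed
  \<comment> \<open>\<open>W\<close> has at most \<open>l (Suc r)\<close> elements and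
    \<open>G\<close>, the set from \<open>strip_rows\<close>, has \<open>l r - l' r\<close>:
    together at most \<open>m\<close>.\<close>
  define W where "W = (\<lambda>x. x mod int (k + 1)) `
      ({bead g (Suc r) - int (k + 1)<..<bead g (Suc r)} - range (bead g))"
  define G where "G = {j \<in> {g' r..<g r}. int j - int r - int (k + 1) \<in> range (bead g)}"
  have gap: "int j - int i \<notin> range (bead g)" if "g' i \<le> j" "j < g i" for i j
    using row_gap[OF anti, of i j] strip[of i] that by auto
  have inW: "residue (k + 1) (i, j) \<in> W" if "g' i \<le> j" "j < g i" "r < i" for i j
  proof -
    have "bead g i \<le> bead g (Suc r)" using that bead_le_iff[OF anti] by simp
    then have "int j - int i < bead g (Suc r)" using that by (simp add: bead_def)
    then show ?thesis
      unfolding W_def using gap_residue_in_window[OF c gap] that by blast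
  qed
  have inr: "residue (k + 1) (r, j) \<in> W \<union> (\<lambda>j. residue (k + 1) (r, j)) ` G"
    if "g' r \<le> j" "j < g r" for j
  proof (cases "j \<in> G")
    case False
    \<comment> \<open>Outside \<open>G\<close> the content lowered by \<open>k + 1\<close> is still
      a gap, now below the bead of row \<open>r + 1\<close>. Row \<open>r + k + 1\<close> merely
      expresses this content.\<close>
    then have ng: "int j - int (r + k + 1) \<notin> range (bead g)" using that by (simp add: G_def algebra_simps)
    have "bead g (r + (k + 1 - l r)) \<le> bead g (Suc r)"
      using lk[of r] bead_le_iff[OF anti] by simp
    then have "int j - int (r + k + 1) < bead g (Suc r)"
      using bead_shift[OF c, of r] that by (simp add: bead_def)
    from gap_residue_in_window[OF c ng this] have "residue (k + 1) (r + k + 1, j) \<in> W"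
      unfolding W_def by simp
    moreover have "residue (k + 1) (r + k + 1, j) = residue (k + 1) (r, j)"
      by (rule residue_shift[where t = "-1"]) simp
    ultimately show ?thesis by simp
  qed blast
  have all: "\<forall>j. g' i \<le> j \<and> j < g i \<longrightarrow> residue (k + 1) (i, j) \<in> W \<union> (\<lambda>j. residue (k + 1) (r, j)) ` G" for i
  proof (induction i rule: measure_induct_rule[where f = "\<lambda>i. r - i"])
    case (less i)
    consider "r < i" | "i = r" | "i < r" by linarith
    then show ?case
    proof cases
      case 3
      \<comment> \<open>As \<open>l' i = l i\<close>, both cores shift row \<open>?i\<close> by
        \<open>l i\<close> columns, so the strip in row \<open>i\<close> is a translate of the one
        in row \<open>?i\<close>, with contents raised by \<open>k + 1\<close>.\<close>
      let ?i = "i + (k + 1 - l i)"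
      have l'i: "l' i = l i" using 3 by (simp add: l'_def)
      have "r - ?i < r - i" using 3 lk[of i] by simp
      note IH = less.IH[OF this]
      show ?thesis
      proof (intro allI impI)
        fix j assume j: "g' i \<le> j \<and> j < g i"
        then have "g' ?i \<le> j - l i" "j - l i < g ?i" "l i \<le> j"
          using geq[of i] geq'[of i] l'i by auto
        moreover have "residue (k + 1) (?i, j - l i) = residue (k + 1) (i, j)"
          using lk[of i] \<open>l i \<le> j\<close> by (intro residue_shift[where t = "-1"]) (simp add: of_nat_diff)
        ultimately show "residue (k + 1) (i, j) \<in> W \<union> (\<lambda>j. residue (k + 1) (r, j)) ` G"
          using IH by metis
      qed
    qed (use inW inr in auto)
  qed
  have "card (residue (k + 1) ` {(i, j). g' i \<le> j \<and> j < g i})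
      \<le> card (W \<union> (\<lambda>j. residue (k + 1) (r, j)) ` G)"
    using all by (intro card_mono) (auto simp: W_def G_def)
  also have "\<dots> \<le> card W + card ((\<lambda>j. residue (k + 1) (r, j)) ` G)" by (rule card_Un_le)
  also have "\<dots> \<le> l (Suc r) + card G"
    unfolding W_def using card_window_gaps[OF c, of "Suc r"]
    by (intro add_mono) (metis card_image_le finite_Diff finite_greaterThanLessThan_int, simp add: G_def card_image_le)
  also have "card G = l r - l' r"
    unfolding G_def using strip by (intro strip_rows(3)[OF c c']) auto
  also have "l (Suc r) + (l r - l' r) = m" using m by (simp add: l'_def)
  finally show ?thesis using c' strip by blast
qed

definition strip_base :: "nat \<Rightarrow> int set \<Rightarrow> (nat \<Rightarrow> nat) \<Rightarrow> nat \<Rightarrow> nat" where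
  "strip_base k R g i =
     (LEAST x. g (Suc i) \<le> x \<and> (\<forall>j. x \<le> j \<and> j < g i \<longrightarrow> residue (k + 1) (i, j) \<in> R))"

text \<open>For flushness, let \<open>j\<close> be the last row of \<open>g\<close> whose bead is at
  least \<open>z = bead g' i - (k + 1)\<close>. It is cut exactly to the bead \<open>z\<close>: its
  cells beyond have the residues of cells removed from row \<open>i\<close>, and one more removed
  cell would allow a further cut in row \<open>i\<close>.\<close>

lemma strip_core:
  assumes c: "core_rows k l g"
  shows "\<exists>l'. core_rows k l' (strip_base k R g)"
    and "strip_base k R g i \<le> g i" and "g (Suc i) \<le> strip_base k R g i"
    and "strip_base k R g i \<le> j \<Longrightarrow> j < g i \<Longrightarrow> residue (k + 1) (i, j) \<in> R"
proof -
  define g' where "g' = strip_base k R g"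
  note anti = core_rowsD(1)[OF c]
  let ?P = "\<lambda>i x. g (Suc i) \<le> x \<and> (\<forall>j. x \<le> j \<and> j < g i \<longrightarrow> residue (k + 1) (i, j) \<in> R)"
  have Pg: "?P i (g i)" for i using antimonoD[OF anti, of i "Suc i"] by auto
  have P: "?P i (g' i)" for i unfolding g'_def strip_base_def by (rule LeastI[of "?P i", OF Pg])
  have le: "g' i \<le> x" if "?P i x" for i x unfolding g'_def strip_base_def by (rule Least_le) (rule that)
  have sub: "g' i \<le> g i" for i by (rule le[OF Pg])
  have hor: "g (Suc i) \<le> g' i" for i using P by blast
  show "strip_base k R g i \<le> g i" "g (Suc i) \<le> strip_base k R g i" for i
    using sub hor by (simp_all add: g'_def)
  show "residue (k + 1) (i, j) \<in> R" if "strip_base k R g i \<le> j" "j < g i" for i j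
    using P that unfolding g'_def by blast
  have anti': "antimono g'"
    unfolding antimono_iff_le_Suc using le_trans[OF sub hor] by blast
  show "\<exists>l'. core_rows k l' (strip_base k R g)"
    unfolding g'_def[symmetric]
  proof (rule core_rows_exI[OF anti'])
    fix i
    define z where "z = bead g' i - int (k + 1)"
    define i' where "i' = i + (k + 1 - l i)"
    have i': "bead g i' = bead g i - int (k + 1)" unfolding i'_def by (rule bead_shift[OF c])
    have zi': "z \<le> bead g i'" unfolding i' z_def using sub[of i] by (simp add: bead_def)
    \<comment> \<open>Only finitely many rows have a bead at least \<open>z\<close>, so there is a
      last one.\<close>
    have "p \<le> nat (int (g 0) - z)" if "z \<le> bead g p" for p
      using that antimonoD[OF anti, of 0 p] by (simp add: bead_def)
    then obtain j where j: "z \<le> bead g j" and jmax: "\<And>p. z \<le> bead g p \<Longrightarrow> p \<le> j"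
      using ex_has_greatest_nat[of "\<lambda>p. z \<le> bead g p" i' id "Suc (nat (int (g 0) - z))"] zi'
      by (auto simp: less_Suc_eq_le)
    have jS: "bead g (Suc j) < z" using jmax[of "Suc j"] by fastforce
    have "i' \<le> j" using jmax[OF zi'] .
    then have jt: "bead g j \<le> bead g i'" by (simp add: bead_le_iff[OF anti])
    define x where "x = nat (z + int j)"
    have x: "int x = z + int j" "g (Suc j) \<le> x" using jS by (auto simp: x_def bead_def)
    have res: "residue (k + 1) (j, y) \<in> R" if "x \<le> y" "y < g j" for y
    proof -
      define y' where "y' = nat (int y - int j + int (k + 1) + int i)"
      have ge: "int y - int j + int (k + 1) + int i \<ge> int (g' i)"
        using x(1) that by (simp add: z_def bead_def)
      then have y': "int y' = int y - int j + int (k + 1) + int i" by (simp add: y'_def)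
      have "int y' < int (g i)" using y' that(2) jt i' by (simp add: bead_def)
      then have "residue (k + 1) (i, y') \<in> R" using P[of i] ge y' by auto
      moreover have "residue (k + 1) (i, y') = residue (k + 1) (j, y)"
        using y' by (intro residue_shift[where t = 1]) simp
      ultimately show ?thesis by simp
    qed
    have "g' j = x"
    proof (rule antisym)
      show "g' j \<le> x" using le[of j x] x res by blast
      show "x \<le> g' j"
      proof (rule ccontr)
        assume "\<not> x \<le> g' j"
        then have lt: "g' j < x" by simp
        have xg: "x \<le> g j" using j x by (simp add: bead_def)
        have r1: "residue (k + 1) (j, x - 1) \<in> R"
          by (rule conjunct2[OF P[of j], rule_format]) (use lt xg in auto)
        have nS: "bead g (Suc j) < z - 1" using hor[of j] lt x by (simp add: bead_def)
        \<comment> \<open>If row \<open>i + 1\<close> blocked a further cut of row \<open>i\<close>,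
          then \<open>z - 1\<close> would be a bead of \<open>g\<close> strictly between those of
          rows \<open>j + 1\<close> and \<open>j\<close>.\<close>
        have gi: "g (Suc i) < g' i"
        proof (rule ccontr)
          assume "\<not> g (Suc i) < g' i"
          then have "bead g (Suc i) = bead g' i - 1" using hor[of i] by (simp add: bead_def)
          then have "z - 1 = bead g (Suc i + (k + 1 - l (Suc i)))"
            using bead_shift[OF c, of "Suc i"] by (simp add: z_def)
          then obtain p where p: "z - 1 = bead g p" by blast
          have "bead g (Suc j) < bead g p" "bead g p < bead g j" using nS j p by linarith+
          then show False by (simp add: bead_less_iff[OF anti])
        qed
        have "residue (k + 1) (i, g' i - 1) = residue (k + 1) (j, x - 1)"
          using gi lt x by (intro residue_shift[where t = 1]) (simp add: of_nat_diff z_def bead_def)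
        then have "residue (k + 1) (i, j) \<in> R" if "g' i - 1 \<le> j" "j < g i" for j
          using P[of i] r1 that by (cases "j = g' i - 1") auto
        then have "?P i (g' i - 1)" using gi by auto
        from le[OF this] show False using gi by simp
      qed
    qed
    then have "bead g' j = z" using x by (simp add: bead_def)
    then show "bead g' i - int (k + 1) \<in> range (bead g')" unfolding z_def by (metis rangeI)
  qed
qed

section \<open>The core of a bounded partition\<close>

lemma part_zero: "length la \<le> i \<Longrightarrow> part la i = 0"
  by (simp add: part_def)

lemma part_pos_iff:
  assumes "is_partition la"
  shows "0 < part la i \<longleftrightarrow> i < length la"
  using assms by (auto simp: is_partition_def part_def) (metis neq0_conv nth_mem)

lemma antimono_part:
  assumes "is_partition la"
  shows "antimono (part la)"
proof (rule antimonoI)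
  fix i j :: nat assume "i \<le> j"
  then show "part la j \<le> part la i"
    using assms sorted_wrt_nth_less[of "(\<ge>)" la i j]
    by (cases "i = j") (auto simp: is_partition_def part_def)
qed

lemma partition_eqI:
  assumes "is_partition la" "is_partition mu" "part la = part mu"
  shows "la = mu"
proof (rule nth_equalityI)
  show len: "length la = length mu"
    using part_pos_iff[OF assms(1)] part_pos_iff[OF assms(2)] assms(3)
    by (metis linorder_neqE_nat order_less_irrefl)
  show "la ! i = mu ! i" if "i < length la" for i
    using fun_cong[OF assms(3), of i] that len by (simp add: part_def)
qed

lemma partition_of_rows:
  assumes "antimono g" "g M = 0"
  obtains mu where "is_partition mu" "part mu = g"
proof
  define n where "n = (LEAST n. g n = 0)"
  have n: "g n = 0" unfolding n_def by (rule LeastI[of _ M]) (rule assms(2))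
  have pos: "0 < g i" if "i < n" for i using not_less_Least[of i "\<lambda>n. g n = 0"] that by (simp add: n_def)
  show "is_partition (map g [0..<n])"
    using pos by (auto simp: is_partition_def sorted_wrt_iff_nth_less image_iff
        intro!: antimonoD[OF assms(1)])
  have "g i = 0" if "n \<le> i" for i using antimonoD[OF assms(1) that] n by simp
  then show "part (map g [0..<n]) = g"
    by (auto simp: part_def fun_eq_iff)
qed

lemma sum_part:
  assumes "length la \<le> M"
  shows "sum (part la) {..<M} = sum_list la"
proof -
  have "sum (part la) {..<M} = sum (part la) {..<length la}"
    using assms by (intro sum.mono_neutral_right) (auto simp: part_def)
  also have "\<dots> = sum_list la"
    by (simp add: sum_list_sum_nth atLeast0LessThan part_def)
  finally show ?thesis .
qed

lemma mem_cells: "(i, j) \<in> cells mu \<longleftrightarrow> j < part mu i"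
  by (simp add: cells_def)

section \<open>Hook lengths and the row equations of a core\<close>

lemma finite_rows_longer: "finite {i'. i < i' \<and> j < part mu i'}"
  by (rule finite_subset[of _ "{..<length mu}"]) (auto simp: part_def split: if_splits)

lemma hook_length_cell:
  assumes "j < part mu i"
  shows "hook_length mu (i, j) = (part mu i - j) + card {i'. i < i' \<and> j < part mu i'}"
proof -
  have "{(i', j') \<in> cells mu. (i' = i \<and> j \<le> j') \<or> (j' = j \<and> i \<le> i')}
      = Pair i ` {j..<part mu i} \<union> (\<lambda>i'. (i', j)) ` {i'. i < i' \<and> j < part mu i'}"
    using assms by (auto simp: mem_cells image_iff le_eq_less_or_eq)
  moreover have "finite {i'. i < i' \<and> j < part mu i'}" by (rule finite_rows_longer)
  ultimately show ?thesis
    unfolding hook_length_def prod.case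
    by (simp, subst card_Un_disjoint) (auto simp: card_image inj_on_def)
qed

lemma leg_bounds:
  assumes "is_partition mu"
  shows "j < part mu (i + q) \<Longrightarrow> q \<le> card {i'. i < i' \<and> j < part mu i'}"
    and "part mu (i + q) \<le> j \<Longrightarrow> 0 < q \<Longrightarrow> card {i'. i < i' \<and> j < part mu i'} < q"
proof -
  note fin = finite_rows_longer[of i j mu]
  note anti = antimonoD[OF antimono_part[OF assms]]
  show "q \<le> card {i'. i < i' \<and> j < part mu i'}" if "j < part mu (i + q)"
  proof -
    have "{i<..i + q} \<subseteq> {i'. i < i' \<and> j < part mu i'}"
      using that anti less_le_trans by fastforce
    from card_mono[OF fin this] show ?thesis by simp
  qed
  show "card {i'. i < i' \<and> j < part mu i'} < q" if "part mu (i + q) \<le> j" "0 < q"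
  proof -
    have "{i'. i < i' \<and> j < part mu i'} \<subseteq> {i<..<i + q}"
      using that(1) anti le_trans by (fastforce simp: not_less[symmetric])
    from card_mono[OF finite_greaterThanLessThan this] show ?thesis using that(2) by simp
  qed
qed

lemma upward_closed_interval:
  assumes "X \<subseteq> {..<n :: nat}" "\<And>x y. x \<in> X \<Longrightarrow> x \<le> y \<Longrightarrow> y < n \<Longrightarrow> y \<in> X"
  shows "X = {n - card X..<n}"
proof (cases "X = {}")
  case False
  have "Inf X \<in> X" using False by (rule Inf_nat_def1)
  then have "X = {Inf X..<n}" "Inf X < n"
    using assms by (auto intro: cInf_lower)
  then show ?thesis by (metis card_atLeastLessThan diff_diff_cancel less_imp_le)
qed simp

text \<open>Hooks weakly decrease along a row, so those at most \<open>k\<close> occupy its last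
  \<open>l i\<close> cells. The cell before them has hook at least \<open>k + 2\<close>, hence leg
  at least \<open>k + 1 - l i\<close>, while the first of them has a smaller leg: the row that many
  steps above ends right between. Conversely, this drop of the leg makes the hooks skip
  \<open>k + 1\<close>.\<close>

lemma core_iff_core_rows:
  assumes mu: "is_partition mu" and bound: "\<And>i. l i \<le> k"
  shows "is_core (k + 1) mu \<and> (\<forall>i. card {j. (i, j) \<in> cells mu \<and> hook_length mu (i, j) \<le> k} = l i)
    \<longleftrightarrow> core_rows k l (part mu)" (is "?A \<longleftrightarrow> ?B")
proof
  assume ?A
  then have nohook: "hook_length mu (i, j) \<noteq> k + 1" if "j < part mu i" for i j
    using that by (auto simp: is_core_def mem_cells)
  have count: "card {j. (i, j) \<in> cells mu \<and> hook_length mu (i, j) \<le> k} = l i" for i using \<open>?A\<close> by blast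
  have "part mu i = l i + part mu (i + (k + 1 - l i))" for i
  proof -
    define X where "X = {j. (i, j) \<in> cells mu \<and> hook_length mu (i, j) \<le> k}"
    define s where "s = part mu i - l i"
    have mono: "hook_length mu (i, y) \<le> hook_length mu (i, x)" if "x \<le> y" "y < part mu i" for x y
    proof -
      have "card {i'. i < i' \<and> y < part mu i'} \<le> card {i'. i < i' \<and> x < part mu i'}"
        using that(1) by (intro card_mono finite_rows_longer) auto
      then show ?thesis using that by (simp add: hook_length_cell)
    qed
    have X: "X = {s..<part mu i}"
      unfolding s_def count[of i, folded X_def, symmetric]
    proof (rule upward_closed_interval)
      show "y \<in> X" if "x \<in> X" "x \<le> y" "y < part mu i" for x y
        using mono[OF that(2,3)] that by (auto simp: X_def mem_cells)
    qed (auto simp: X_def mem_cells)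
    have "l i \<le> part mu i"
      using count[of i, folded X_def] X by (metis card_atLeastLessThan diff_le_self)
    have "s \<le> part mu (i + (k + 1 - l i))"
    proof (cases s)
      case (Suc s')
      have s': "s' < part mu i" "s' \<notin> X" using Suc by (auto simp: X s_def)
      then have "k + 2 \<le> hook_length mu (i, s')"
        using nohook[of s' i] by (force simp: X_def mem_cells)
      then have "k + 1 - l i \<le> card {i'. i < i' \<and> s' < part mu i'}"
        using s' Suc \<open>l i \<le> part mu i\<close> by (simp add: hook_length_cell s_def)
      then have "\<not> part mu (i + (k + 1 - l i)) \<le> s'"
        using leg_bounds(2)[OF mu, of i "k + 1 - l i" s'] bound[of i] by auto
      then show ?thesis using Suc by simp
    qed simp
    moreover have "part mu (i + (k + 1 - l i)) \<le> s"
    proof (cases "l i = 0")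
      case True
      then show ?thesis using antimonoD[OF antimono_part[OF mu], of i] by (simp add: s_def)
    next
      case False
      then have s: "s < part mu i" using \<open>l i \<le> part mu i\<close> by (simp add: s_def)
      then have "s \<in> X" by (simp add: X)
      then have "hook_length mu (i, s) \<le> k" by (simp add: X_def)
      then have "card {i'. i < i' \<and> s < part mu i'} < k + 1 - l i"
        using s \<open>l i \<le> part mu i\<close> by (simp add: hook_length_cell s_def)
      then show ?thesis using leg_bounds(1)[OF mu, of s i "k + 1 - l i"] by force
    qed
    ultimately show ?thesis using \<open>l i \<le> part mu i\<close> by (simp add: s_def)
  qed
  then show ?B unfolding core_rows_def using antimono_part[OF mu] bound by blast
next
  assume B: ?B
  have small: "hook_length mu (i, j) \<le> k \<longleftrightarrow> part mu (i + (k + 1 - l i)) \<le> j"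
    and ne: "hook_length mu (i, j) \<noteq> k + 1" if "j < part mu i" for i j
  proof -
    note eq = core_rowsD(3)[OF B, of i]
    have "hook_length mu (i, j) \<le> k" if "part mu (i + (k + 1 - l i)) \<le> j"
      using leg_bounds(2)[OF mu that] hook_length_cell[OF \<open>j < part mu i\<close>] that eq bound[of i] by linarith
    moreover have "k + 2 \<le> hook_length mu (i, j)" if "\<not> part mu (i + (k + 1 - l i)) \<le> j"
      using leg_bounds(1)[OF mu, of j i "k + 1 - l i"] hook_length_cell[OF \<open>j < part mu i\<close>] that eq
        bound[of i] by linarith
    ultimately show "hook_length mu (i, j) \<le> k \<longleftrightarrow> part mu (i + (k + 1 - l i)) \<le> j"
      "hook_length mu (i, j) \<noteq> k + 1" by fastforce+
  qed
  have "{j. (i, j) \<in> cells mu \<and> hook_length mu (i, j) \<le> k}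
      = {part mu (i + (k + 1 - l i))..<part mu i}" for i
    using small by (auto simp: mem_cells)
  then have "card {j. (i, j) \<in> cells mu \<and> hook_length mu (i, j) \<le> k} = l i" for i
    using core_rowsD(3)[OF B, of i] by (metis add_diff_cancel_right' card_atLeastLessThan)
  then show ?A using mu ne by (auto simp: is_core_def mem_cells)
qed

text \<open>Existence by \<open>core_row\<close> and uniqueness by \<open>core_rows_inject\<close>
  justify the definite description in \<open>core_of\<close>.\<close>

lemma core_of_rows:
  assumes la: "is_partition la" "k_bounded k la"
  shows "is_partition (core_of k la)" "core_rows k (part la) (part (core_of k la))"
proof -
  let ?P = "\<lambda>mu. is_core (k + 1) mu \<and>
     (\<forall>i. card {j. (i, j) \<in> cells mu \<and> hook_length mu (i, j) \<le> k} = part la i)"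
  have bound: "part la i \<le> k" for i using la(2) by (simp add: k_bounded_def part_def)
  note iff = core_iff_core_rows[of _ "part la" k, OF _ bound]
  have core: "core_rows k (part la) (core_row k (part la) (length la))"
    by (rule core_rows_core_row(1)[OF antimono_part[OF la(1)] bound part_zero])
  moreover have "core_row k (part la) (length la) (length la) = 0" by (simp add: core_row.simps)
  ultimately obtain mu where mu: "is_partition mu" "part mu = core_row k (part la) (length la)"
    using partition_of_rows core_rowsD(1) by blast
  have "\<exists>!mu. ?P mu"
  proof (rule ex1I)
    show "?P mu" using iff[OF mu(1)] core mu(2) by simp
    fix nu assume nu: "?P nu"
    then have pnu: "is_partition nu" by (simp add: is_core_def)
    then have cnu: "core_rows k (part la) (part nu)" using iff nu by blast
    have "part nu = part mu"
      by (rule core_rows_inject[OF cnu core[folded mu(2)], of "max (length nu) (length mu)"])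
        (simp add: part_zero)
    then show "nu = mu" using partition_eqI[OF pnu mu(1)] by blast
  qed
  then have P: "?P (core_of k la)" unfolding core_of_def by (rule theI')
  then show "is_partition (core_of k la)" by (simp add: is_core_def)
  then show "core_rows k (part la) (part (core_of k la))" using iff P by blast
qed

section \<open>Weights of k-tableaux\<close>

lemma k_weight_pos:
  assumes "c \<in> cells mu"
  shows "0 < k_weight k mu T (T c)"
  using assms finite_cells[of mu] unfolding k_weight_def by (cases c) (auto simp: card_gt_0_iff)

lemma k_weight_eq_0:
  assumes "\<And>c. c \<in> cells mu \<Longrightarrow> T c \<noteq> m"
  shows "k_weight k mu T m = 0"
  unfolding k_weight_def using assms by (metis (mono_tags, lifting) Collect_empty_eq card.empty image_empty)

text \<open>In a horizontal strip the tail of \<open>l\<close> from \<open>s + 1\<close> is at most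
  the tail of \<open>l'\<close> from \<open>s\<close>; comparing totals bounds the initial
  sums.\<close>

lemma sum_strip_le:
  fixes l l' :: "nat \<Rightarrow> nat"
  assumes zero: "\<And>i. M \<le> i \<Longrightarrow> l i = 0" and sub: "\<And>i. l' i \<le> l i" and hor: "\<And>i. l (Suc i) \<le> l' i"
    and R: "sum l {..<M} = sum l' {..<M} + R"
  shows "sum l' {..<s} + R \<le> sum l {..<Suc s}"
proof -
  define P where "P = max M s"
  have zero': "l' i = 0" if "M \<le> i" for i using sub[of i] zero[OF that] by simp
  have ext: "sum f {..<p} = sum f {..<M}" if "M \<le> p" "\<And>i. M \<le> i \<Longrightarrow> f i = 0" for f :: "nat \<Rightarrow> nat" and p
    using that by (intro sum.mono_neutral_right) auto
  have "sum l {..<Suc P} = sum l {..<Suc s} + sum l {Suc s..<Suc P}"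
    unfolding lessThan_atLeast0 by (rule sum.atLeastLessThan_concat[symmetric]) (simp_all add: P_def)
  moreover have "sum l {Suc s..<Suc P} \<le> sum l' {s..<P}"
    unfolding sum.shift_bounds_Suc_ivl by (intro sum_mono hor)
  moreover have "sum l' {..<P} = sum l' {..<s} + sum l' {s..<P}"
    unfolding lessThan_atLeast0 by (rule sum.atLeastLessThan_concat[symmetric]) (simp_all add: P_def)
  moreover have "sum l {..<Suc P} = sum l' {..<P} + R"
    using ext[of "Suc P" l] ext[of P l'] zero zero' R by (simp add: P_def)
  ultimately show ?thesis by linarith
qed

lemma ssytD:
  assumes "T \<in> ssyt mu"
  shows "0 < T c \<longleftrightarrow> c \<in> cells mu"
    and "j' < part mu i \<Longrightarrow> j \<le> j' \<Longrightarrow> T (i, j) \<le> T (i, j')"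
    and "j < part mu i \<Longrightarrow> j < part mu i' \<Longrightarrow> i < i' \<Longrightarrow> T (i, j) < T (i', j)"
proof -
  show "0 < T c \<longleftrightarrow> c \<in> cells mu" using assms unfolding ssyt_def by blast
  show "T (i, j) \<le> T (i, j')" if "j' < part mu i" "j \<le> j'"
    using assms that by (cases "j = j'") (auto simp: ssyt_def mem_cells)
  show "T (i, j) < T (i', j)" if "j < part mu i" "j < part mu i'" "i < i'"
    using assms that by (simp add: ssyt_def mem_cells)
qed

lemma k_weight_tableau_0:
  assumes "T \<in> ssyt mu"
  shows "k_weight k mu T 0 = 0"
proof (rule k_weight_eq_0)
  show "T c \<noteq> 0" if "c \<in> cells mu" for c using ssytD(1)[OF assms, of c] that by simp
qed

text \<open>Both claims share one induction on the largest entry, because equality for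
  \<open>T\<close> passes to the smaller tableau only by means of the inequality for that
  tableau.\<close>

lemma tableau_weight_bound:
  assumes "is_partition mu" "core_rows k l (part mu)" "\<And>i. M \<le> i \<Longrightarrow> part mu i = 0"
    and "T \<in> ssyt mu" "\<And>c. T c \<le> N"
  shows "sum l {..<M} \<le> sum (k_weight k mu T) {1..N} \<and>
    (sum l {..<M} = sum (k_weight k mu T) {1..N} \<longrightarrow>
      (\<forall>S\<subseteq>{1..N}. sum (k_weight k mu T) S \<le> sum l {..<card S}))"
  using assms
proof (induction N arbitrary: mu l T)
  case 0
  then have "cells mu = {}" using ssytD(1)[OF 0(4)] by auto
  then have "part mu i = 0" for i using mem_cells[of i 0 mu] by simp
  then have "l i = 0" for i using core_rowsD(3)[OF 0(2), of i] by simp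
  then show ?case by simp
next
  case (Suc N)
  note c = Suc.prems(2) and T = Suc.prems(4)
  define g where "g = part mu"
  define R where "R = residue (k + 1) ` {c \<in> cells mu. T c = Suc N}"
  define g' where "g' = strip_base k R g"
  have finR: "finite R" by (simp add: R_def finite_cells)
  have cardR: "card R = k_weight k mu T (Suc N)" by (simp add: R_def k_weight_def)
  note sc = strip_core[OF c, where R = R, folded g_def, folded g'_def]
  obtain l' where c': "core_rows k l' g'" using sc(1) by blast
  have zero: "g' i = 0" "l i = 0" if "M \<le> i" for i
    using sc(2)[of i] Suc.prems(3)[OF that] core_rowsD(3)[OF c, of i] by (auto simp: g_def)
  obtain mu' where mu': "is_partition mu'" "part mu' = g'"
    using partition_of_rows[OF core_rowsD(1)[OF c'], of M] zero by blast
  have cells': "cells mu' \<subseteq> cells mu"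
    using sc(2) less_le_trans by (fastforce simp: cells_def mu'(2) g_def)
  define T' where "T' c = (if c \<in> cells mu' then T c else 0)" for c
  have T': "T' \<in> ssyt mu'"
    unfolding ssyt_def
  proof (intro CollectI conjI allI impI)
    show "(0 < T' c) = (c \<in> cells mu')" for c using ssytD(1)[OF T, of c] cells' by (auto simp: T'_def)
    show "T' (i, j) \<le> T' (i, j')" if "(i, j) \<in> cells mu'" "(i, j') \<in> cells mu'" "j < j'" for i j j'
      using that subsetD[OF cells' that(2)] ssytD(2)[OF T, of j' i j] by (simp add: T'_def mem_cells)
    show "T' (i, j) < T' (i', j)" if "(i, j) \<in> cells mu'" "(i', j) \<in> cells mu'" "i < i'" for i i' j
      using that subsetD[OF cells' that(1)] subsetD[OF cells' that(2)] ssytD(3)[OF T, of j i i']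
      by (simp add: T'_def mem_cells)
  qed
  \<comment> \<open>A cell with entry \<open>Suc N\<close> is followed in its row only by equal
    entries and has no cell above it, so \<open>strip_base\<close> removes it.\<close>
  have T'N: "T' c \<le> N" for c
  proof (rule ccontr)
    assume *: "\<not> T' c \<le> N"
    obtain i j where c: "c = (i, j)" by (cases c)
    have j: "j < g' i" and "T (i, j) = Suc N"
      using * Suc.prems(5)[of c] by (auto simp: T'_def c mem_cells mu'(2) split: if_splits)
    then have eq: "T (i, j') = Suc N" if "j \<le> j'" "j' < g i" for j'
      using ssytD(2)[OF T, of j' i j] that Suc.prems(5)[of "(i, j')"] by (simp add: g_def)
    have "g (Suc i) \<le> j"
    proof (rule ccontr)
      assume "\<not> g (Suc i) \<le> j"
      then have "T (i, j) < T (Suc i, j)"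
        using j sc(2)[of i] by (intro ssytD(3)[OF T]) (auto simp: g_def)
      then show False using Suc.prems(5)[of "(Suc i, j)"] \<open>T (i, j) = Suc N\<close> by simp
    qed
    moreover have "residue (k + 1) (i, j') \<in> R" if "j \<le> j'" "j' < g i" for j'
      using eq[OF that] that by (auto simp: R_def mem_cells g_def)
    ultimately have "g' i \<le> j" unfolding g'_def strip_base_def by (intro Least_le) blast
    then show False using j by simp
  qed
  have IH: "sum l' {..<M} \<le> sum (k_weight k mu' T') {1..N}"
    "\<And>S. sum l' {..<M} = sum (k_weight k mu' T') {1..N} \<Longrightarrow> S \<subseteq> {1..N} \<Longrightarrow>
      sum (k_weight k mu' T') S \<le> sum l' {..<card S}"
    using Suc.IH[OF mu'(1) _ _ T' T'N, of l'] c' zero by (auto simp: mu'(2))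
  \<comment> \<open>The removed ends may also contain smaller entries, so weights can drop.\<close>
  have kw: "k_weight k mu' T' m \<le> k_weight k mu T m" for m
    unfolding k_weight_def using cells' finite_cells[of mu]
    by (intro card_mono finite_imageI image_mono) (auto simp: T'_def)
  have kws: "sum (k_weight k mu' T') {1..N} \<le> sum (k_weight k mu T) {1..N}" by (intro sum_mono kw)
  have tot: "sum (k_weight k mu T) {1..Suc N} = sum (k_weight k mu T) {1..N} + card R"
    by (simp add: cardR)
  have loss: "sum l {..<M} \<le> sum l' {..<M} + card R"
    using sum_loss_le_residues[OF c[folded g_def] c' sc(2,3) finR] sc(4) by blast
  show ?case
  proof (intro conjI impI allI)
    show "sum l {..<M} \<le> sum (k_weight k mu T) {1..Suc N}" using loss tot IH(1) kws by linarith
  next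
    fix S assume eq: "sum l {..<M} = sum (k_weight k mu T) {1..Suc N}" and S: "S \<subseteq> {1..Suc N}"
    \<comment> \<open>Equal totals force equality in every estimate used, so no weight of a smaller
      entry has dropped.\<close>
    have eqs: "sum l' {..<M} = sum (k_weight k mu' T') {1..N}"
      "sum (k_weight k mu' T') {1..N} = sum (k_weight k mu T) {1..N}"
      "sum l {..<M} = sum l' {..<M} + card R"
      using loss tot IH(1) kws eq by linarith+
    have kweq: "k_weight k mu' T' m = k_weight k mu T m" if "m \<in> {1..N}" for m
      using sum_mono_inv[OF eqs(2) kw that] by simp
    have dom: "sum (k_weight k mu T) S \<le> sum l' {..<card S}" if "S \<subseteq> {1..N}" for S
      using IH(2)[OF eqs(1) that] kweq that by (simp add: subset_iff cong: sum.cong)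
    note sr = strip_rows[OF c[folded g_def] c' sc(2,3)]
    show "sum (k_weight k mu T) S \<le> sum l {..<card S}"
    proof (cases "Suc N \<in> S")
      case False
      then have "S \<subseteq> {1..N}" using S by (auto simp: subset_iff le_Suc_eq)
      then show ?thesis using dom sum_mono[of "{..<card S}" l' l] sr(1) le_trans by blast
    next
      case True
      have fin: "finite S" using S finite_subset by blast
      have "S - {Suc N} \<subseteq> {1..N}" using S by (auto simp: subset_iff le_Suc_eq)
      from dom[OF this] have "sum (k_weight k mu T) S \<le> sum l' {..<card (S - {Suc N})} + card R"
        using sum.remove[OF fin True, of "k_weight k mu T"] cardR by simp
      also have "\<dots> \<le> sum l {..<Suc (card (S - {Suc N}))}"
        using zero(2) sr(1,2) eqs(3) by (intro sum_strip_le[where M = M]) auto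
      also have "Suc (card (S - {Suc N})) = card S" using fin True by (rule card_Suc_Diff1)
      finally show ?thesis .
    qed
  qed
qed

text \<open>\<open>l'\<close> is the greedy remainder from \<open>greedy_strip\<close>. Its initial
  sums show that dominance survives the removal of the strip.\<close>

lemma sum_merge_parts:
  fixes l :: "nat \<Rightarrow> nat"
  assumes m: "l (Suc r) \<le> m" "m \<le> l r"
  defines "l' \<equiv> \<lambda>i. if i < r then l i else if i = r then l r + l (Suc r) - m else l (Suc i)"
  shows "s \<le> r \<Longrightarrow> sum l' {..<s} = sum l {..<s}"
    and "r < s \<Longrightarrow> sum l' {..<s} + m = sum l {..<Suc s}"
proof -
  show low: "sum l' {..<s} = sum l {..<s}" if "s \<le> r" for s
    using that by (intro sum.cong) (auto simp: l'_def)
  show "sum l' {..<s} + m = sum l {..<Suc s}" if "r < s"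
    using that
  proof (induction s)
    case (Suc s)
    then consider "r = s" | "r < s" by linarith
    then show ?case
    proof cases
      case 1
      then show ?thesis using low[of s] m by (simp add: l'_def)
    next
      case 2
      then show ?thesis using Suc.IH by (simp add: l'_def)
    qed
  qed simp
qed

lemma tableau_exists:
  assumes "is_partition mu" "core_rows k l (part mu)" "\<And>i. M \<le> i \<Longrightarrow> part mu i = 0"
    and "\<And>S. S \<subseteq> {1..N} \<Longrightarrow> sum a S \<le> sum l {..<card S}"
    and "sum a {1..N} = sum l {..<M}" and "\<And>m. m \<notin> {1..N} \<Longrightarrow> a m = 0"
  shows "\<exists>T\<in>ssyt mu. k_weight k mu T = a"
  using assms
proof (induction N arbitrary: mu l a)
  case 0
  have lz: "l i = 0" for i
    using 0(5) 0(3)[of i] core_rowsD(3)[OF 0(2), of i] by (cases "M \<le> i") auto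
  have "part mu = (\<lambda>_. 0)"
  proof (rule core_rows_inject[OF 0(2)])
    show "core_rows k l (\<lambda>_. 0)" using lz by (simp add: core_rows_def antimono_def)
  qed (use 0(3) in auto)
  then have "cells mu = {}" by (auto simp: cells_def)
  then have "(\<lambda>_. 0) \<in> ssyt mu" by (simp add: ssyt_def)
  moreover have "k_weight k mu (\<lambda>_. 0) = a"
    using 0(6) \<open>cells mu = {}\<close> by (auto simp: fun_eq_iff k_weight_def)
  ultimately show ?case by blast
next
  case (Suc N)
  note mu = Suc.prems(1) and c = Suc.prems(2) and dom = Suc.prems(4) and tot = Suc.prems(5)
    and out = Suc.prems(6)
  define m where "m = a (Suc N)"
  show ?case
  proof (cases "m = 0")
    case True
    show ?thesis
    proof (rule Suc.IH[OF mu c Suc.prems(3)])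
      show "sum a S \<le> sum l {..<card S}" if "S \<subseteq> {1..N}" for S
        using that by (intro dom) auto
      show "sum a {1..N} = sum l {..<M}" using tot True by (simp add: m_def)
      show "a i = 0" if "i \<notin> {1..N}" for i
        using out[of i] True that by (cases "i = Suc N") (auto simp: m_def)
    qed
  next
    case False
    define g where "g = part mu"
    have lz: "l i = 0" if "M \<le> i" for i
      using Suc.prems(3)[OF that] core_rowsD(3)[OF c, of i] by simp
    have "m \<le> l 0" using dom[of "{Suc N}"] by (simp add: m_def)
    moreover have "i \<le> M" if "m \<le> l i" for i using lz[of i] that False by (cases "M \<le> i") auto
    \<comment> \<open>The last row with at least \<open>m\<close> cells; there
      \<open>l (Suc r) \<le> m \<le> l r\<close>, as the greedy strip demands.\<close>
    ultimately obtain r where r: "m \<le> l r" and rmax: "\<And>i. m \<le> l i \<Longrightarrow> i \<le> r"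
      using Nat.ex_has_greatest_nat[of "\<lambda>i. m \<le> l i" 0 M] by blast
    have r': "l (Suc r) \<le> m" using rmax[of "Suc r"] by fastforce
    have rM: "r < M" using lz[of r] r False by fastforce
    define l' where "l' = (\<lambda>i. if i < r then l i else if i = r then l r + l (Suc r) - m else l (Suc i))"
    have gz: "g i = 0" if "M \<le> i" for i using Suc.prems(3) that by (simp add: g_def)
    have "\<exists>g'. core_rows k l' g' \<and> (\<forall>i. g' i \<le> g i \<and> g (Suc i) \<le> g' i) \<and>
        card (residue (k + 1) ` {(i, j). g' i \<le> j \<and> j < g i}) \<le> m"
      unfolding l'_def by (rule greedy_strip[OF c[folded g_def] gz r' r])
    then obtain g' where c': "core_rows k l' g'" and sub: "\<And>i. g' i \<le> g i"
      and hor: "\<And>i. g (Suc i) \<le> g' i"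
      and res: "card (residue (k + 1) ` {(i, j). g' i \<le> j \<and> j < g i}) \<le> m"
      by blast
    have zero: "g' i = 0" if "M \<le> i" for i using sub[of i] gz[OF that] by simp
    obtain mu' where mu': "is_partition mu'" "part mu' = g'"
      using partition_of_rows[OF core_rowsD(1)[OF c'], of M] zero by blast
    note merge = sum_merge_parts[OF r' r, folded l'_def]
    have tot': "sum l' {..<M} + m = sum l {..<M}" using merge(2)[OF rM] lz[of M] by simp
    define a' where "a' = a(Suc N := 0)"
    have a': "sum a' S = sum a S" if "S \<subseteq> {1..N}" for S
      using that by (intro sum.cong) (auto simp: a'_def)
    have "\<exists>T\<in>ssyt mu'. k_weight k mu' T = a'"
    proof (rule Suc.IH[OF mu'(1)])
      show "core_rows k l' (part mu')" using c' mu' by simp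
      show "part mu' i = 0" if "M \<le> i" for i using zero[OF that] mu' by simp
      \<comment> \<open>Up to \<open>r\<close> the initial sums of \<open>l\<close> and
        \<open>l'\<close> agree; beyond \<open>r\<close>, dominance is applied to \<open>S\<close>
        with \<open>Suc N\<close> added, which pays for \<open>m\<close>.\<close>
      show "sum a' S \<le> sum l' {..<card S}" if S: "S \<subseteq> {1..N}" for S
      proof (cases "card S \<le> r")
        case True
        have "S \<subseteq> {1..Suc N}" using S by auto
        from dom[OF this] show ?thesis using merge(1)[OF True] by (simp add: a'[OF S])
      next
        case False
        have "Suc N \<notin> S" "finite S" using S finite_subset by auto
        then have "sum a (insert (Suc N) S) = m + sum a S" "card (insert (Suc N) S) = Suc (card S)"
          by (auto simp: m_def)
        moreover have "insert (Suc N) S \<subseteq> {1..Suc N}" using S by auto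
        ultimately have "m + sum a S \<le> sum l {..<Suc (card S)}" using dom by metis
        then show ?thesis using merge(2)[of "card S"] False by (simp add: a'[OF S])
      qed
      show "sum a' {1..N} = sum l' {..<M}" using tot tot' by (simp add: a' m_def)
      show "a' i = 0" if "i \<notin> {1..N}" for i using out[of i] that by (auto simp: a'_def)
    qed
    then obtain T' where T': "T' \<in> ssyt mu'" "k_weight k mu' T' = a'" by blast
    have T'N: "T' c \<le> N" for c
    proof (cases "c \<in> cells mu'")
      case True
      then have "0 < a' (T' c)" using k_weight_pos T'(2) by metis
      then show ?thesis using out[of "T' c"] by (auto simp: a'_def le_Suc_eq split: if_splits)
    next
      case False
      then show ?thesis using ssytD(1)[OF T'(1), of c] by simp
    qed
    have cells': "cells mu' \<subseteq> cells mu"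
      using sub less_le_trans by (fastforce simp: cells_def mu'(2) g_def)
    define T where "T c = (if c \<in> cells mu' then T' c else if c \<in> cells mu then Suc N else 0)" for c
    have T: "T \<in> ssyt mu"
      unfolding ssyt_def
    proof (intro CollectI conjI allI impI)
      show "(0 < T c) = (c \<in> cells mu)" for c using ssytD(1)[OF T'(1), of c] cells' by (auto simp: T_def)
      show "T (i, j) \<le> T (i, j')" if "(i, j) \<in> cells mu" "(i, j') \<in> cells mu" "j < j'" for i j j'
        using that ssytD(2)[OF T'(1), of j' i j] le_SucI[OF T'N[of "(i, j)"]]
        by (simp add: T_def mem_cells)
      show "T (i, j) < T (i', j)" if "(i, j) \<in> cells mu" "(i', j) \<in> cells mu" "i < i'" for i i' j
      proof -
        have "g i' \<le> g (Suc i)" using antimonoD[OF core_rowsD(1)[OF c]] that(3) by (simp add: g_def)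
        then have ij: "(i, j) \<in> cells mu'" using hor[of i] that by (simp add: mem_cells mu' g_def)
        show ?thesis
        proof (cases "(i', j) \<in> cells mu'")
          case True
          then show ?thesis using ij ssytD(3)[OF T'(1)] that by (simp add: T_def mem_cells)
        next
          case False
          then show ?thesis using ij that T'N[of "(i, j)"] by (simp add: T_def)
        qed
      qed
    qed
    have "k_weight k mu T x = a x" for x
    proof (cases "x = Suc N")
      case True
      have eq: "{c \<in> cells mu. T c = Suc N} = {(i, j). g' i \<le> j \<and> j < g i}"
        using T'N cells' by (auto simp: T_def mem_cells mu' g_def) (metis Suc_n_not_le_n)
      have fin: "finite {c \<in> cells mu. T c = Suc N}" using finite_cells[of mu] by simp
      \<comment> \<open>The strip has at most \<open>m\<close> residues by the greedy choice, and at
        least \<open>m\<close> because \<open>m\<close> cells of the bounded partition are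
        lost.\<close>
      have "sum l {..<M} \<le> sum l' {..<M} + card (residue (k + 1) ` {(i, j). g' i \<le> j \<and> j < g i})"
        by (rule sum_loss_le_residues[OF c[folded g_def] c' sub hor]) (use fin eq in auto)
      then show ?thesis using res tot' True by (simp add: k_weight_def eq m_def)
    next
      case False
      show ?thesis
      proof (cases "x = 0")
        case True
        then show ?thesis using k_weight_tableau_0[OF T] out[of 0] by simp
      next
        case x: False
        have "{c \<in> cells mu. T c = x} = {c \<in> cells mu'. T' c = x}"
          using False x cells' by (auto simp: T_def)
        then have "k_weight k mu T x = k_weight k mu' T' x" by (simp add: k_weight_def)
        then show ?thesis using T'(2) False by (simp add: a'_def)
      qed
    qed
    then show ?thesis using T by blast
  qed
qed

section \<open>Integer points of the permutahedron\<close>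

text \<open>The integer bases of the polymatroid whose rank function is the sum of the
  \<open>card S\<close> largest parts. For a partition with more parts than variables the set is
  empty, matching a zero polynomial.\<close>

definition dominated :: "nat list \<Rightarrow> (nat ^ 'n) set" where
  "dominated la = {a. (\<Sum>i\<in>UNIV. a $ i) = sum_list la \<and>
     (\<forall>S. (\<Sum>i\<in>S. a $ i) \<le> sum (part la) {..<card S})}"

text \<open>Concavity of the initial sums makes the rank function submodular.\<close>

lemma sum_initial_concave:
  fixes l :: "nat \<Rightarrow> nat"
  assumes "antimono l" "p \<le> q"
  shows "sum l {..<q + d} + sum l {..<p} \<le> sum l {..<q} + sum l {..<p + d}"
proof (induction d)
  case (Suc d)
  have "l (q + d) \<le> l (p + d)" using assms(2) by (intro antimonoD[OF assms(1)]) simp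
  then show ?case using Suc by simp
qed simp

lemma sum_le_sum_initial:
  fixes l :: "nat \<Rightarrow> nat"
  assumes "antimono l" "finite X"
  shows "sum l X \<le> sum l {..<card X}"
  using assms(2)
proof (induction X rule: finite_linorder_max_induct)
  case (insert b X)
  have "X \<subseteq> {..<b}" using insert.hyps by auto
  from card_mono[OF _ this] have "l b \<le> l (card X)"
    by (intro antimonoD[OF assms(1)]) simp
  moreover have "b \<notin> X" using insert.hyps by auto
  ultimately show ?case using insert by simp
qed simp

text \<open>Tight sets are closed under union by submodularity. If no exchange were possible, a largest
  tight set avoiding \<open>i\<close> would contain every \<open>j\<close> with \<open>a $ j < b $ j\<close>, so that \<open>b\<close> would have a
  smaller total than \<open>a\<close>.\<close>

lemma M_convex_dominated:
  assumes "is_partition la"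
  shows "M_convex (dominated la :: (nat ^ 'n) set)"
  unfolding M_convex_def
proof (intro ballI allI impI)
  fix a b :: "nat ^ 'n" and i
  assume a: "a \<in> dominated la" and b: "b \<in> dominated la" and i: "b $ i < a $ i"
  define A where "A S = (\<Sum>x\<in>S. a $ x)" for S
  define B where "B S = (\<Sum>x\<in>S. b $ x)" for S
  define f where "f S = sum (part la) {..<card S}" for S :: "'n set"
  have A: "A UNIV = sum_list la" "A S \<le> f S" and B: "B UNIV = sum_list la" "B S \<le> f S" for S
    using a b by (auto simp: dominated_def A_def B_def f_def)
  have mod: "A (S \<union> S') + A (S \<inter> S') = A S + A S'" for S S'
    unfolding A_def by (rule sum.union_inter) auto
  have submod: "f (S \<union> S') + f (S \<inter> S') \<le> f S + f S'" for S S' :: "'n set"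
  proof -
    have "card S + card S' = card (S \<union> S') + card (S \<inter> S')" by (rule card_Un_Int) auto
    moreover have "card (S \<inter> S') \<le> card S" "card (S \<inter> S') \<le> card S'" by (auto intro: card_mono)
    ultimately show ?thesis
      using sum_initial_concave[OF antimono_part[OF assms], of "card (S \<inter> S')" "card S"
          "card S' - card (S \<inter> S')"]
      by (simp add: f_def)
  qed
  have union: "A (S \<union> S') = f (S \<union> S')" if "A S = f S" "A S' = f S'" for S S'
    using mod[of S S'] submod[of S S'] A(2)[of "S \<union> S'"] A(2)[of "S \<inter> S'"] that by linarith
  define F where "F = {S. A S = f S \<and> i \<notin> S}"
  have "{} \<in> F" by (simp add: F_def A_def f_def)
  then obtain S0 where S0: "S0 \<in> F" and max: "\<And>S. S \<in> F \<Longrightarrow> card S \<le> card S0"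
    using ex_has_greatest_nat[of "\<lambda>S. S \<in> F" "{}" card "Suc (CARD('n))"]
    by (auto simp: less_Suc_eq_le card_mono)
  have "\<exists>j. j \<notin> S0 \<and> a $ j < b $ j"
  proof (rule ccontr)
    assume "\<not> ?thesis"
    then have "B (- S0) < A (- S0)"
      unfolding A_def B_def using S0 i by (intro sum_strict_mono_ex1) (auto simp: F_def not_less)
    moreover have "B S0 \<le> A S0" using B(2)[of S0] S0 by (simp add: F_def)
    moreover have "A UNIV = A S0 + A (- S0)" "B UNIV = B S0 + B (- S0)"
      unfolding A_def B_def by (metis finite_code Compl_disjoint Compl_partition sum.union_disjoint)+
    ultimately show False using A(1) B(1) by linarith
  qed
  then obtain j where j: "j \<notin> S0" "a $ j < b $ j" by blast
  have ij: "i \<noteq> j" using i j by auto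
  define a' where "a' = a - axis i 1 + axis j 1"
  \<comment> \<open>Stated additively to stay clear of truncated subtraction.\<close>
  have A': "(\<Sum>x\<in>S. a' $ x) + of_bool (i \<in> S) = A S + of_bool (j \<in> S)" for S
  proof -
    have "(\<Sum>x\<in>S. a' $ x) + (\<Sum>x\<in>S. of_bool (x = i)) = A S + (\<Sum>x\<in>S. of_bool (x = j))"
      unfolding A_def sum.distrib[symmetric] using i ij
      by (intro sum.cong) (auto simp: a'_def axis_def)
    then show ?thesis by (simp add: of_bool_def sum.delta)
  qed
  have "(\<Sum>x\<in>S. a' $ x) \<le> f S" for S
  proof (cases "j \<in> S \<and> i \<notin> S")
    case True
    \<comment> \<open>Only sets containing \<open>j\<close> but not \<open>i\<close> gain, and they
      have room: a tight one could be joined to \<open>S0\<close>, giving a larger member of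
      \<open>F\<close>.\<close>
    have "A S \<noteq> f S"
    proof
      assume "A S = f S"
      then have "S0 \<union> S \<in> F" using S0 union[of S0 S] True by (simp add: F_def)
      then have "card (S0 \<union> S) \<le> card S0" by (rule max)
      then have "S0 \<union> S = S0" by (metis card_seteq finite_code sup_ge1)
      then show False using True j by blast
    qed
    then show ?thesis using A'[of S] A(2)[of S] True by simp
  next
    case False
    then show ?thesis using A'[of S] A(2)[of S] by (auto simp: of_bool_def split: if_splits)
  qed
  moreover have "(\<Sum>x\<in>UNIV. a' $ x) = sum_list la" using A'[of UNIV] A(1) by simp
  ultimately show "\<exists>j. a $ j < b $ j \<and> a - axis i 1 + axis j 1 \<in> dominated la"
    using j unfolding a'_def by (intro exI[of _ j]) (simp add: dominated_def f_def)
qed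

text \<open>The real solutions \<open>H\<close> of the same linear conditions form a convex set
  containing the hull, and every integer point of \<open>H\<close> is dominated.\<close>

lemma saturated_dominated:
  "real_vec ` dominated la = convex hull (real_vec ` dominated la) \<inter> {x :: real ^ 'n. \<forall>i. x $ i \<in> \<int>}"
proof (intro equalityI subsetI)
  fix x :: "real ^ 'n"
  assume "x \<in> real_vec ` dominated la"
  then show "x \<in> convex hull (real_vec ` dominated la) \<inter> {x. \<forall>i. x $ i \<in> \<int>}"
    by (auto simp: real_vec_def intro: hull_inc)
next
  fix x :: "real ^ 'n"
  assume x: "x \<in> convex hull (real_vec ` dominated la) \<inter> {x. \<forall>i. x $ i \<in> \<int>}"
  define H where "H = {y :: real ^ 'n. (\<forall>i. 0 \<le> y $ i) \<and> (\<Sum>i\<in>UNIV. y $ i) = real (sum_list la) \<and>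
    (\<forall>S. (\<Sum>i\<in>S. y $ i) \<le> real (sum (part la) {..<card S}))}"
  have "convex H"
  proof (rule convexI)
    fix y z :: "real ^ 'n" and u v :: real
    assume y: "y \<in> H" and z: "z \<in> H" and uv: "0 \<le> u" "0 \<le> v" "u + v = 1"
    have sum: "(\<Sum>i\<in>S. (u *\<^sub>R y + v *\<^sub>R z) $ i) = u * (\<Sum>i\<in>S. y $ i) + v * (\<Sum>i\<in>S. z $ i)" for S
      by (simp add: sum.distrib sum_distrib_left)
    have eq: "u * c + v * c = c" for c using uv(3) by (metis distrib_right mult_1)
    show "u *\<^sub>R y + v *\<^sub>R z \<in> H"
      using y z uv unfolding H_def mem_Collect_eq sum
      by (auto simp: eq intro!: convex_bound_le add_nonneg_nonneg)
  qed
  moreover have "real_vec ` dominated la \<subseteq> H"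
    by (auto simp: H_def real_vec_def dominated_def of_nat_sum[symmetric] simp del: of_nat_sum)
  ultimately have "x \<in> H" using x hull_minimal[of "real_vec ` dominated la" H convex] by blast
  define a where "a = (\<chi> i. nat \<lfloor>x $ i\<rfloor>)"
  have ax: "real (a $ i) = x $ i" for i
  proof -
    have "0 \<le> x $ i" "x $ i \<in> \<int>" using \<open>x \<in> H\<close> x by (auto simp: H_def)
    then show ?thesis by (auto simp: a_def elim!: Ints_cases)
  qed
  have sum: "real (\<Sum>i\<in>S. a $ i) = (\<Sum>i\<in>S. x $ i)" for S by (simp add: ax)
  have "a \<in> dominated la"
    using \<open>x \<in> H\<close> unfolding H_def dominated_def mem_Collect_eq sum[symmetric] of_nat_eq_iff of_nat_le_iff
    by blast
  moreover have "x = real_vec a" by (simp add: real_vec_def vec_eq_iff ax)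
  ultimately show "x \<in> real_vec ` dominated la" by blast
qed

section \<open>Dominated points and the permutahedron\<close>

lemma ex_increasing_enumeration:
  fixes w :: "'a :: finite \<Rightarrow> real"
  obtains e where "bij_betw e {..<CARD('a)} UNIV" "\<And>s t. s \<le> t \<Longrightarrow> t < CARD('a) \<Longrightarrow> w (e s) \<le> w (e t)"
proof -
  obtain xs :: "'a list" where xs: "set xs = UNIV" "distinct xs"
    using finite_distinct_list[of "UNIV :: 'a set"] by auto
  define ys where "ys = sort_key w xs"
  have ys: "set ys = UNIV" "distinct ys" "sorted (map w ys)" by (simp_all add: ys_def xs)
  have len: "length ys = CARD('a)" using distinct_card[OF ys(2)] ys(1) by simp
  show thesis
  proof
    show "bij_betw ((!) ys) {..<CARD('a)} UNIV"
      by (rule bij_betw_nth) (use ys len in auto)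
    show "w (ys ! s) \<le> w (ys ! t)" if "s \<le> t" "t < CARD('a)" for s t
      using sorted_nth_mono[OF ys(3) that(1)] that len by simp
  qed
qed

text \<open>In each step a nonnegative initial sum of \<open>d\<close> is multiplied by a larger
  weight. The full sum may have any sign; in the application it is 0.\<close>

lemma Abel_sum_le:
  fixes w d :: "nat \<Rightarrow> real"
  assumes "\<And>t. t < n \<Longrightarrow> w t \<le> w (Suc t)" and "\<And>t. t \<le> n \<Longrightarrow> 0 \<le> sum d {..<t}"
  shows "(\<Sum>t<Suc n. w t * d t) \<le> w n * sum d {..<Suc n}"
  using assms
proof (induction n)
  case (Suc n)
  have "(\<Sum>t<Suc n. w t * d t) \<le> w n * sum d {..<Suc n}"
    using Suc.prems by (intro Suc.IH) auto
  also have "\<dots> \<le> w (Suc n) * sum d {..<Suc n}"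
    by (rule mult_right_mono) (use Suc.prems in blast)+
  finally show ?case by (simp add: algebra_simps)
qed simp

text \<open>Rado's theorem. A hyperplane separating a point from the permutahedron would, by Abel
  summation along an ordering of its coefficients, also separate it from a vertex.\<close>

lemma dominated_in_permutahedron:
  fixes a :: "nat ^ 'n"
  assumes len: "length la \<le> CARD('n)" and a: "a \<in> dominated la"
  shows "real_vec a \<in> permutahedron la"
proof (rule ccontr)
  define V where "V = {(\<chi> i. real (part la (s i))) |s. bij_betw s (UNIV :: 'n set) {..<CARD('n)}}"
  assume "real_vec a \<notin> permutahedron la"
  then have notin: "real_vec a \<notin> convex hull V" by (simp add: permutahedron_def V_def)
  have "finite V"
  proof (rule finite_subset)
    show "V \<subseteq> (\<lambda>s. \<chi> i. real (part la (s i))) ` (UNIV \<rightarrow>\<^sub>E {..<CARD('n)})"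
      by (auto simp: V_def bij_betw_def PiE_UNIV_domain Pi_iff)
  qed (intro finite_imageI finite_PiE, auto)
  then have "closed (convex hull V)" by (intro compact_imp_closed finite_imp_compact_convex_hull)
  from separating_hyperplane_closed_point[OF convex_convex_hull this notin]
  obtain w c where w: "w \<bullet> real_vec a < c" and c: "\<forall>x\<in>convex hull V. c < w \<bullet> x" by blast
  obtain e where e: "bij_betw e {..<CARD('n)} UNIV"
    and mono: "\<And>s t. s \<le> t \<Longrightarrow> t < CARD('n) \<Longrightarrow> w $ e s \<le> w $ e t"
    using ex_increasing_enumeration[of "($) w"] by blast
  define s where "s = the_inv_into {..<CARD('n)} e"
  have s: "bij_betw s UNIV {..<CARD('n)}" unfolding s_def by (rule bij_betw_the_inv_into[OF e])
  have se: "s (e t) = t" if "t < CARD('n)" for t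
    using that e unfolding s_def by (intro the_inv_into_f_f) (auto simp: bij_betw_def)
  \<comment> \<open>The vertex minimising \<open>w\<close>: the largest parts meet the smallest
    coefficients.\<close>
  define v where "v = (\<chi> i. real (part la (s i)))"
  have inner: "w \<bullet> x = (\<Sum>t<CARD('n). w $ e t * x $ e t)" for x
    unfolding inner_vec_def inner_real_def by (rule sum.reindex_bij_betw[OF e, symmetric])
  define d where "d t = real (part la t) - real (a $ e t)" for t
  have partial: "(\<Sum>t<p. a $ e t) = (\<Sum>i\<in>e ` {..<p}. a $ i)" "card (e ` {..<p}) = p" if "p \<le> CARD('n)" for p
  proof -
    have "inj_on e {..<p}" using e that by (auto simp: bij_betw_def intro: inj_on_subset)
    then show "(\<Sum>t<p. a $ e t) = (\<Sum>i\<in>e ` {..<p}. a $ i)" "card (e ` {..<p}) = p"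
      by (simp_all add: sum.reindex card_image)
  qed
  have d: "0 \<le> sum d {..<p}" if "p \<le> CARD('n)" for p
  proof -
    have "(\<Sum>t<p. a $ e t) \<le> sum (part la) {..<p}"
      using a partial[OF that] by (metis (mono_tags, lifting) dominated_def mem_Collect_eq)
    then show ?thesis by (simp add: d_def sum_subtractf of_nat_sum[symmetric] del: of_nat_sum)
  qed
  have "e ` {..<CARD('n)} = UNIV" using e by (simp add: bij_betw_def)
  then have "(\<Sum>t<CARD('n). a $ e t) = sum (part la) {..<CARD('n)}"
    using a partial(1)[of "CARD('n)"] sum_part[OF len] by (simp add: dominated_def)
  then have d0: "sum d {..<CARD('n)} = 0"
    by (simp add: d_def sum_subtractf of_nat_sum[symmetric] del: of_nat_sum)
  obtain N where N: "CARD('n) = Suc N" using not0_implies_Suc[of "CARD('n)"] by auto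
  have "(\<Sum>t<Suc N. w $ e t * d t) \<le> w $ e N * sum d {..<Suc N}"
    using mono d by (intro Abel_sum_le[where w = "\<lambda>t. w $ e t"]) (auto simp: N)
  then have "(\<Sum>t<CARD('n). w $ e t * d t) \<le> 0" using d0 by (simp add: N)
  then have "w \<bullet> v \<le> w \<bullet> real_vec a"
    unfolding inner by (simp add: v_def real_vec_def d_def se right_diff_distrib sum_subtractf)
  moreover have "v \<in> convex hull V" using s by (intro hull_inc) (auto simp: V_def v_def)
  ultimately show False using w c by force
qed

lemma convex_hull_dominated:
  assumes la: "is_partition la" and len: "length la \<le> CARD('n)"
  shows "convex hull (real_vec ` dominated la) = (permutahedron la :: (real ^ 'n) set)"
proof
  show "convex hull (real_vec ` dominated la) \<subseteq> (permutahedron la :: (real ^ 'n) set)"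
  proof (rule hull_minimal)
    show "convex (permutahedron la :: (real ^ 'n) set)" by (simp add: permutahedron_def)
  qed (use dominated_in_permutahedron[OF len] in blast)
  show "(permutahedron la :: (real ^ 'n) set) \<subseteq> convex hull (real_vec ` dominated la)"
    unfolding permutahedron_def
  proof (rule hull_mono, clarify)
    fix s assume s: "bij_betw s (UNIV :: 'n set) {..<CARD('n)}"
    define v where "v = (\<chi> i. part la (s i))"
    have inj: "inj_on s S" for S using s by (auto simp: bij_betw_def intro: inj_on_subset)
    have sum: "(\<Sum>i\<in>S. v $ i) = sum (part la) (s ` S)" for S
      using inj by (simp add: v_def sum.reindex)
    have "v \<in> dominated la"
      unfolding dominated_def mem_Collect_eq sum
    proof (intro conjI allI)
      have "s ` UNIV = {..<CARD('n)}" using s by (simp add: bij_betw_def)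
      then show "sum (part la) (range s) = sum_list la" using sum_part[OF len] by simp
      show "sum (part la) (s ` S) \<le> sum (part la) {..<card S}" for S
        using sum_le_sum_initial[OF antimono_part[OF la], of "s ` S"] by (simp add: card_image inj)
    qed
    then show "(\<chi> i. real (part la (s i))) \<in> real_vec ` dominated la"
      by (intro image_eqI[of _ _ v]) (simp_all add: real_vec_def v_def)
  qed
qed

section \<open>The support of the dual k-Schur polynomial\<close>

lemma tableau_entries_bounded:
  assumes T: "T \<in> ssyt mu" and out: "\<And>m. m \<notin> {1..n} \<Longrightarrow> k_weight k mu T m = 0"
  shows "T c \<le> n" and "sum (k_weight k mu T) (T ` cells mu) = sum (k_weight k mu T) {1..n}"
proof -
  \<comment> \<open>Every entry that occurs has positive \<open>k\<close>-weight, so a weight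
    vanishing outside \<open>{1..n}\<close> confines the entries.\<close>
  have rng: "T c \<in> {1..n}" if "c \<in> cells mu" for c
    using out[of "T c"] k_weight_pos[OF that, of k T] by force
  then show "T c \<le> n" using ssytD(1)[OF T, of c] by (cases "c \<in> cells mu") auto
  show "sum (k_weight k mu T) (T ` cells mu) = sum (k_weight k mu T) {1..n}"
    using rng by (intro sum.mono_neutral_left ballI k_weight_eq_0) auto
qed

lemma dominated_iff_pad_exponent:
  fixes a :: "nat ^ 'n"
  shows "a \<in> dominated la \<longleftrightarrow> sum (pad_exponent a) {1..CARD('n)} = sum_list la \<and>
    (\<forall>S\<subseteq>{1..CARD('n)}. sum (pad_exponent a) S \<le> sum (part la) {..<card S})"
proof -
  define h where "h m = from_nat_into (UNIV :: 'n set) (m - 1)" for m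
  have "bij_betw (\<lambda>m. m - 1) {1..CARD('n)} {..<CARD('n)}"
    by (rule bij_betw_byWitness[where f' = Suc]) auto
  from bij_betw_trans[OF this bij_betw_from_nat_into_finite[of "UNIV :: 'n set"]]
  have h: "bij_betw h {1..CARD('n)} UNIV" by (simp add: h_def[abs_def] comp_def)
  have sum: "sum (pad_exponent a) S = (\<Sum>i\<in>h ` S. a $ i)" and card: "card (h ` S) = card S"
    if "S \<subseteq> {1..CARD('n)}" for S
  proof -
    have "inj_on h S" using h that by (auto simp: bij_betw_def intro: inj_on_subset)
    then have "card (h ` S) = card S" "(\<Sum>i\<in>h ` S. a $ i) = (\<Sum>m\<in>S. a $ h m)"
      by (simp_all add: card_image sum.reindex)
    moreover have "sum (pad_exponent a) S = (\<Sum>m\<in>S. a $ h m)"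
      using that by (intro sum.cong) (auto simp: pad_exponent_def h_def)
    ultimately show "card (h ` S) = card S" "sum (pad_exponent a) S = (\<Sum>i\<in>h ` S. a $ i)" by simp_all
  qed
  have img: "h ` {1..CARD('n)} = UNIV" using h by (simp add: bij_betw_def)
  have "\<exists>S'\<subseteq>{1..CARD('n)}. S = h ` S'" for S
    using img by (metis subset_UNIV subset_imageE)
  then have "(\<forall>S. (\<Sum>i\<in>S. a $ i) \<le> sum (part la) {..<card S}) \<longleftrightarrow>
      (\<forall>S\<subseteq>{1..CARD('n)}. sum (pad_exponent a) S \<le> sum (part la) {..<card S})"
    using sum card by metis
  then show ?thesis using sum[of "{1..CARD('n)}"] img by (simp add: dominated_def)
qed

text \<open>Coefficients count tableaux, so nothing cancels and the support is the set of attained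
  weights.\<close>

lemma supp_dual_k_schur_poly:
  assumes la: "is_partition la" "k_bounded k la"
  shows "supp (dual_k_schur_poly k la :: (nat ^ 'n) \<Rightarrow>\<^sub>0 int) = dominated la"
proof (intro set_eqI)
  fix a :: "nat ^ 'n"
  define mu where "mu = core_of k la"
  define M where "M = max (length la) (length mu)"
  note core = core_of_rows[OF la, folded mu_def]
  have zero: "part mu i = 0" if "M \<le> i" for i using that by (simp add: part_zero M_def)
  have tot: "sum (part la) {..<M} = sum_list la" by (rule sum_part) (simp add: M_def)
  have out: "pad_exponent a m = 0" if "m \<notin> {1..CARD('n)}" for m using that by (auto simp: pad_exponent_def)
  define X where "X = {T \<in> k_tableaux k la. k_weight k mu T = pad_exponent a}"
  have X: "T \<in> ssyt mu" "T c \<le> CARD('n)" "sum (pad_exponent a) {1..CARD('n)} = sum_list la"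
    if "T \<in> X" for T c
  proof -
    have T: "T \<in> ssyt mu" "k_weight k mu T = pad_exponent a"
      "sum (k_weight k mu T) (T ` cells mu) = sum_list la"
      using that by (auto simp: X_def k_tableaux_def mu_def)
    then show "T \<in> ssyt mu" "T c \<le> CARD('n)" "sum (pad_exponent a) {1..CARD('n)} = sum_list la"
      using tableau_entries_bounded[OF T(1), of "CARD('n)" k] out by simp_all
  qed
  have "X \<subseteq> {T. \<forall>c. (c \<in> cells mu \<longrightarrow> T c \<in> {..CARD('n)}) \<and> (c \<notin> cells mu \<longrightarrow> T c = 0)}"
    using X(1,2) ssytD(1) by (auto simp del: split_paired_All) (metis neq0_conv)
  \<comment> \<open>An infinite \<open>X\<close> would have cardinality 0, so finiteness is what
    turns a nonzero coefficient into \<open>X \<noteq> {}\<close>.\<close>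
  then have "finite X"
    using finite_set_of_finite_funs[OF finite_cells[of mu] finite_atMost[of "CARD('n)"]] finite_subset by blast
  have "a \<in> supp (dual_k_schur_poly k la :: (nat ^ 'n) \<Rightarrow>\<^sub>0 int) \<longleftrightarrow> X \<noteq> {}"
    unfolding supp_def in_keys_iff lookup_dual_k_schur_poly dual_k_schur_def
    using \<open>finite X\<close> by (simp add: X_def mu_def)
  also have "\<dots> \<longleftrightarrow> a \<in> dominated la"
  proof
    assume "X \<noteq> {}"
    then obtain T where T: "T \<in> X" by blast
    then have kw: "k_weight k mu T = pad_exponent a" by (simp add: X_def)
    show "a \<in> dominated la"
      using tableau_weight_bound[OF core zero X(1,2)[OF T]] X(3)[OF T] tot
      by (simp add: dominated_iff_pad_exponent kw)
  next
    assume a: "a \<in> dominated la"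
    then have "\<exists>T\<in>ssyt mu. k_weight k mu T = pad_exponent a"
      using out tot by (intro tableau_exists[OF core zero, where N = "CARD('n)"])
        (auto simp: dominated_iff_pad_exponent)
    then obtain T where T: "T \<in> ssyt mu" "k_weight k mu T = pad_exponent a" by blast
    have "sum (k_weight k mu T) (T ` cells mu) = sum_list la"
      using tableau_entries_bounded(2)[OF T(1), of "CARD('n)" k] T(2) out a
      by (simp add: dominated_iff_pad_exponent)
    then have "T \<in> X" using T by (simp add: X_def k_tableaux_def mu_def)
    then show "X \<noteq> {}" by blast
  qed
  finally show "a \<in> supp (dual_k_schur_poly k la) \<longleftrightarrow> a \<in> dominated la" .
qed

theorem theorem3p8:
  fixes k :: nat and la :: "nat list"
  assumes "k \<ge> 1" and "is_partition la" and "k_bounded k la"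
  shows "saturated_newton_polytope (dual_k_schur_poly k la :: (nat ^ 'n) \<Rightarrow>\<^sub>0 int)
    \<and> (length la \<le> CARD('n) \<longrightarrow>
         newton (dual_k_schur_poly k la :: (nat ^ 'n) \<Rightarrow>\<^sub>0 int) = permutahedron la)
    \<and> M_convex (supp (dual_k_schur_poly k la :: (nat ^ 'n) \<Rightarrow>\<^sub>0 int))"
  unfolding saturated_newton_polytope_def newton_def supp_dual_k_schur_poly[OF assms(2,3)]
  using saturated_dominated convex_hull_dominated[OF assms(2)] M_convex_dominated[OF assms(2)]
  by blast

end
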